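(* Let $n>10$ be an integer and let $P$ be the maximal prime number with $P\le n$. If $k$ is an integer with $2\le k\le n-P$, then there exists a prime number $p>2k$ which divides one of the numbers $n, n-1,\ldots,n-(k-1)$. *)

theory Defs
  imports Complex_Main "HOL-Computational_Algebra.Primes"
begin

end

theory Submission
  imports Defs "HOL-Analysis.Harmonic_Numbers" "HOL-Number_Theory.Prime_Powers"
    "HOL-Number_Theory.Pocklington" "HOL-Library.Discrete_Functions"
begin

text \<open>
  Suppose that all prime factors of \<open>n, \<dots>, n - k + 1\<close> are at most \<open>2k\<close> and that none of these
  numbers is prime; write \<open>m = n - k\<close>. Two arguments bound \<open>n\<close> in terms of \<open>k\<close>.

  (1) Erdos: remove, for each prime \<open>p \<le> 2k\<close>, one of the numbers with maximal \<open>p\<close>-adic valuation.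
  The product of the remaining ones divides \<open>(k - 1)!\<close>, so \<open>(m + 1) ^ (k - \<pi>(2k)) \<le> (k - 1)!\<close>.
  This gives a small explicit bound on \<open>n\<close> for \<open>5 \<le> k < 100\<close>, and \<open>4 (m + 1) < k\<^sup>2\<close> once
  \<open>\<pi>(2k) \<le> k / 2\<close>. For \<open>k \<le> 4\<close> the numbers removed for \<open>2\<close> and \<open>3\<close> are almost pure powers,
  which leads to \<open>2 ^ x - 3 ^ y = \<plusminus>1\<close>.

  (2) For \<open>k \<ge> 100\<close>, only primes up to \<open>2k\<close> and higher prime powers up to \<open>n\<close> contribute to
  \<open>n choose k\<close>, so \<open>ln (n choose k) \<le> \<psi>(2k) + 2 \<psi>(\<surd>n)\<close>. With Chebyshev's bound \<open>\<psi>(x) \<le> 1.106 x + 3 \<surd>x\<close>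
  this forces \<open>n < c k\<close>, where \<open>c\<close> decreases from \<open>30\<close> to \<open>5\<close> as \<open>n\<close> grows.

  Thus \<open>k\<close> is so large compared to \<open>n\<close> that the window must contain a prime: for large \<open>n\<close> by Chebyshev's
  estimates, since \<open>k > n / 5\<close>, and for small \<open>n\<close> by an explicit chain of primes with small gaps.
\<close>

section \<open>Chebyshev's estimates\<close>

definition psi :: "nat \<Rightarrow> real" where
  "psi n = (\<Sum>d=1..n. mangoldt d)"

lemma psi_0 [simp]: "psi 0 = 0"
  by (simp add: psi_def)

lemma psi_mono: "m \<le> n \<Longrightarrow> psi m \<le> psi n"
  unfolding psi_def by (intro sum_mono2) (auto simp: mangoldt_nonneg)

lemma Suc_div_eq: "d > 0 \<Longrightarrow> Suc n div d = n div d + (if d dvd Suc n then 1 else 0)"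
  by (simp add: div_Suc mod_eq_0_iff_dvd)

text \<open>Passing from \<open>n\<close> to \<open>n + 1\<close> adds \<open>ln (n + 1)\<close>,
  the sum of \<open>mangoldt\<close> over the divisors of \<open>n + 1\<close>. The free upper limit
  \<open>N\<close> lets factorials of different sizes be combined term by term.\<close>

lemma ln_fact_eq_sum_mangoldt:
  "n \<le> N \<Longrightarrow> ln (fact n) = (\<Sum>d=1..N. mangoldt d * real (n div d))"
proof (induction n)
  case (Suc n)
  have "ln (fact (Suc n) :: real) = ln (real (Suc n)) + ln (fact n)"
    by (simp add: ln_mult add_ac del: of_nat_Suc)
  also have "ln (real (Suc n)) = (\<Sum>d | d dvd Suc n. mangoldt d)"
    using mangoldt_sum[of "Suc n", where ?'a = real] by simp
  also have "\<dots> = (\<Sum>d=1..N. if d dvd Suc n then mangoldt d else 0)"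
    using Suc.prems dvd_imp_le[of _ "Suc n"]
    by (intro sum.mono_neutral_cong_left) (auto intro!: Nat.gr0I simp: Suc_le_eq, fastforce)
  also have "\<dots> + ln (fact n) = (\<Sum>d=1..N. mangoldt d * real (Suc n div d))"
    using Suc by (simp add: Suc_div_eq sum.distrib[symmetric]) (intro sum.cong; auto simp: algebra_simps)
  finally show ?case .
qed auto

text \<open>
  Chebyshev's factorial quotient: its expansion in \<open>mangoldt\<close> has coefficients in \<open>{0, 1}\<close>, with value \<open>1\<close>
  for \<open>n / 6 < d \<le> n\<close>, while its logarithm is \<open>0.9212\<dots> n\<close> up to \<open>O(ln n)\<close>.
\<close>
lemma chebyshev_factor_cases:
  fixes m :: nat
  shows "m + m div 30 \<in> {m div 2 + m div 3 + m div 5, m div 2 + m div 3 + m div 5 + 1}"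
proof -
  define q r where "q = m div 30" and "r = m mod 30"
  have m: "m = 30 * q + r" by (simp add: q_def r_def)
  have r: "r < 30" by (simp add: r_def)
  \<comment> \<open>Since \<open>30 + 1 = 15 + 10 + 6\<close>, the contributions of \<open>q\<close>
    to both sides cancel and only the residue modulo 30 has to be checked.\<close>
  have d: "(30 * q + r) div 2 = 15 * q + r div 2" "(30 * q + r) div 3 = 10 * q + r div 3"
    "(30 * q + r) div 5 = 6 * q + r div 5"
    by presburger+
  have "\<forall>r\<in>{..<30}. r = r div 2 + r div 3 + r div 5 \<or> r = r div 2 + r div 3 + r div 5 + (1::nat)"
    by (simp add: lessThan_nat_numeral lessThan_Suc)
  with r have "r = r div 2 + r div 3 + r div 5 \<or> r = r div 2 + r div 3 + r div 5 + 1"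
    by auto
  thus ?thesis unfolding m d using r by auto
qed

definition chebyshev_quot :: "nat \<Rightarrow> real" where
  "chebyshev_quot n = ln (fact n) - ln (fact (n div 2)) - ln (fact (n div 3))
     - ln (fact (n div 5)) + ln (fact (n div 30))"

lemma chebyshev_quot_eq:
  "chebyshev_quot n = (\<Sum>d=1..n. mangoldt d *
     (real (n div d) + real (n div d div 30) - real (n div d div 2) - real (n div d div 3) - real (n div d div 5)))"
proof -
  have "(n div k) div d = (n div d) div k" for k d
    by (simp add: div_mult2_eq[symmetric] mult.commute)
  thus ?thesis unfolding chebyshev_quot_def
    using ln_fact_eq_sum_mangoldt[of "n div 30" n] ln_fact_eq_sum_mangoldt[of "n div 2" n]
      ln_fact_eq_sum_mangoldt[of "n div 3" n] ln_fact_eq_sum_mangoldt[of "n div 5" n]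
      ln_fact_eq_sum_mangoldt[of n n]
    by (simp add: sum_subtractf[symmetric] sum.distrib[symmetric] algebra_simps)
qed

lemma chebyshev_quot_le_psi: "chebyshev_quot n \<le> psi n"
  unfolding chebyshev_quot_eq psi_def
proof (intro sum_mono)
  fix d
  show "mangoldt d * (real (n div d) + real (n div d div 30) - real (n div d div 2)
          - real (n div d div 3) - real (n div d div 5)) \<le> mangoldt d" (is "_ * ?c \<le> _")
  proof -
    have "?c \<le> 1" using chebyshev_factor_cases[of "n div d"] by auto
    thus ?thesis using mult_left_mono[of ?c 1 "mangoldt d"] mangoldt_nonneg by simp
  qed
qed

lemma psi_le_chebyshev_quot: "psi n \<le> psi (n div 6) + chebyshev_quot n"
proof -
  have "psi n - psi (n div 6) = (\<Sum>d\<in>{1..n}-{1..n div 6}. mangoldt d)"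
    unfolding psi_def by (subst sum_diff) auto
  also have "\<dots> = (\<Sum>d=1..n. if d \<le> n div 6 then 0 else mangoldt d)"
    by (intro sum.mono_neutral_cong_left) auto
  also have "\<dots> \<le> chebyshev_quot n" unfolding chebyshev_quot_eq
  proof (intro sum_mono)
    fix d assume d: "d \<in> {1..n}"
    let ?m = "n div d"
    let ?c = "real ?m + real (?m div 30) - real (?m div 2) - real (?m div 3) - real (?m div 5)"
    have c: "?c \<ge> 0" using chebyshev_factor_cases[of ?m] by auto
    have "?c = 1" if "\<not> d \<le> n div 6"
    proof -
      have "n < 6 * d" using that by (simp add: not_le less_eq_div_iff_mult_less_eq mult.commute div_less_iff_less_mult)
      hence "?m < 6" using d by (simp add: div_less_iff_less_mult)
      moreover have "?m \<ge> 1" using d by (simp add: Suc_le_eq div_greater_zero_iff)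
      ultimately have "?m \<in> {1,2,3,4,5}" by auto
      thus ?thesis by auto
    qed
    thus "(if d \<le> n div 6 then 0 else mangoldt d) \<le> mangoldt d * ?c"
      using c mangoldt_nonneg[of d] by auto
  qed
  finally show ?thesis by simp
qed

section \<open>Explicit Stirling bounds and the size of Chebyshev's quotient\<close>

lemma ln_fact_ge: "n \<ge> 1 \<Longrightarrow> real n * ln n - n + 1 \<le> ln (fact n)"
proof (induction n rule: dec_induct)
  case (step n)
  have n: "real n > 0" using step by simp
  have "ln ((real n + 1) / n) \<le> (real n + 1) / n - 1"
    using n by (intro ln_le_minus_one) auto
  also have "\<dots> = 1 / n" using n by (simp add: field_simps)
  finally have "real n * (ln (real n + 1) - ln n) \<le> 1"
    using n by (simp add: ln_div field_simps)
  moreover have "ln (fact (Suc n) :: real) = ln (real n + 1) + ln (fact n)"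
    by (simp add: ln_mult add_ac)
  ultimately show ?case using step.IH by (simp add: algebra_simps)
qed auto

text \<open>As for the lower bound, the inductive step is \<open>ln t \<le> t - 1\<close>, now at
  \<open>t = n / (n + 1)\<close> instead of \<open>t = (n + 1) / n\<close>.\<close>

lemma ln_fact_le: "n \<ge> 1 \<Longrightarrow> ln (fact n) \<le> real n * ln n - n + ln n + 1"
proof (induction n rule: dec_induct)
  case (step n)
  have n: "real n > 0" using step by simp
  have "ln (real n / (real n + 1)) \<le> real n / (real n + 1) - 1"
    using n by (intro ln_le_minus_one) auto
  also have "\<dots> = - 1 / (real n + 1)" using n by (simp add: field_simps)
  finally have "(real n + 1) * (ln (real n + 1) - ln n) \<ge> 1"
    using n by (simp add: ln_div field_simps)
  moreover have "ln (fact (Suc n) :: real) = ln (real n + 1) + ln (fact n)"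
    by (simp add: ln_mult add_ac)
  ultimately show ?case using step.IH by (simp add: algebra_simps)
qed auto

text \<open>Stating the bound in \<open>x\<close> instead of its integer part \<open>m\<close>
  removes all rounding when \<open>x = n / q\<close>. The growth
  \<open>ln x - ln m \<ge> (x - m) / x\<close> pays for replacing \<open>- m\<close> by
  \<open>- x\<close>.\<close>

lemma ln_fact_floor_le:
  fixes x :: real
  assumes "1 \<le> m" "real m \<le> x" "x < real m + 1"
  shows "ln (fact m) \<le> x * ln x - x + ln x + 1"
proof -
  have m: "real m \<ge> 1" and x: "x \<ge> 1" using assms by auto
  have "ln (m / x) \<le> m / x - 1" using m x by (intro ln_le_minus_one) auto
  hence *: "(x - m) / x \<le> ln x - ln m" using m x by (simp add: ln_div field_simps)
  have "x - m \<le> (m + 1) * ((x - m) / x)"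
    using x assms mult_right_mono[of x "m+1" "x - m"] by (simp add: field_simps)
  also have "\<dots> \<le> (m + 1) * (ln x - ln m)" using * by (intro mult_left_mono) auto
  finally have "x - m \<le> (m + 1) * (ln x - ln m) + (x - m) * ln x"
    using x assms(2) by (smt (verit) ln_ge_zero mult_nonneg_nonneg)
  thus ?thesis using ln_fact_le[OF assms(1)] by (simp add: algebra_simps)
qed

text \<open>The bound is \<open>(x - 1) * (ln x - 1)\<close>, which increases for
  \<open>x \<ge> 2\<close>, so it is compared with its value at \<open>m + 1\<close>. For
  \<open>x < 2\<close> it is not positive.\<close>

lemma ln_fact_floor_ge:
  fixes x :: real
  assumes "1 \<le> m" "real m \<le> x" "x < real m + 1"
  shows "x * ln x - x - ln x + 1 \<le> ln (fact m)"
proof (cases "m = 1")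
  case True
  have "ln x \<le> 1" using assms True ln_le_minus_one[of x] by simp
  hence "(x - 1) * (ln x - 1) \<le> 0" using assms True by (intro mult_nonneg_nonpos) auto
  thus ?thesis using True by (simp add: algebra_simps)
next
  case False
  define y where "y = real m + 1"
  have xy: "2 \<le> x" "x < y" "3 \<le> y" using assms False by (auto simp: y_def)
  have "ln 2 \<le> ln x" using xy by simp
  hence lx: "ln x \<ge> 1 / y" using ln2_ge_two_thirds xy
    by (smt (verit) frac_le)
  have "ln (x / y) \<le> x / y - 1" using xy by (intro ln_le_minus_one) auto
  hence *: "(y - x) / y \<le> ln y - ln x" using xy by (simp add: ln_div field_simps)
  have "0 \<le> (y - x) * (ln x - 1 / y)" using xy lx by (intro mult_nonneg_nonneg) auto
  also have "\<dots> = (y - 1) * ((y - x) / y) + (y - x) * (ln x - 1)"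
    using xy by (simp add: field_simps)
  also have "\<dots> \<le> (y - 1) * (ln y - ln x) + (y - x) * (ln x - 1)"
    using xy by (intro add_right_mono mult_left_mono *) auto
  finally have "x * ln x - x - ln x + 1 \<le> y * ln y - y + 1 - ln y"
    by (simp add: algebra_simps)
  also have "\<dots> \<le> ln (fact m)"
  proof -
    have "ln (fact (Suc m) :: real) = ln y + ln (fact m)"
      by (simp add: ln_mult y_def add_ac)
    thus ?thesis using ln_fact_ge[of "Suc m"] by (simp add: y_def add_ac)
  qed
  finally show ?thesis .
qed

lemma ln_fact_div_bounds:
  assumes "0 < q" "q \<le> n"
  defines "x \<equiv> real n / real q"
  shows "ln (fact (n div q)) \<in> {x * ln x - x - ln x + 1 .. x * ln x - x + ln x + 1}"
proof -
  have "1 \<le> n div q" using assms by (simp add: Suc_le_eq div_greater_zero_iff)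
  moreover have "real (n div q) \<le> x" unfolding x_def by (simp add: of_nat_div_le_of_nat)
  moreover have "x < real (n div q) + 1"
  proof -
    have "n < (n div q + 1) * q" using assms dividend_less_div_times[of q n] by simp
    hence "real n < real ((n div q + 1) * q)" by (simp only: of_nat_less_iff)
    thus ?thesis using assms by (simp add: x_def field_simps)
  qed
  ultimately show ?thesis using ln_fact_floor_le ln_fact_floor_ge by auto
qed

lemma ln_2_approx: "ln 2 \<in> {0.6931<..<(0.6932::real)}"
  and ln_3_approx: "ln 3 \<in> {1.0986<..<(1.0987::real)}"
  and ln_5_approx: "ln 5 \<in> {1.6094<..<(1.6095::real)}"
  using ln_approx_bounds[of 2 5] ln_approx_bounds[of 3 7] ln_approx_bounds[of 5 14]
  by (simp_all add: Let_def lessThan_nat_numeral lessThan_Suc power_divide)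

text \<open>Because \<open>1 - 1/2 - 1/3 - 1/5 + 1/30 = 0\<close>, the terms of order
  \<open>x * ln x\<close> and the terms \<open>- x\<close> cancel. What is left is
  \<open>c * x\<close> with Chebyshev's constant \<open>c\<close>, and five error terms
  \<open>ln (x / q)\<close>, which add up to \<open>5 * ln x - 2 * ln 30\<close>.\<close>

lemma chebyshev_quot_bounds:
  assumes "n \<ge> 30"
  shows "chebyshev_quot n \<ge> 0.9209 * n - 5 * ln n + 5.7"
    and "chebyshev_quot n \<le> 0.9214 * n + 5 * ln n - 7.7"
proof -
  define x where "x = real n"
  have x: "x > 0" using assms by (simp add: x_def)
  have l: "ln (30::real) = ln 2 + ln 3 + ln 5"
    using ln_mult[of 2 15] ln_mult[of 3 5] by simp
  have *: "ln (fact n) \<in> {x * ln x - x - ln x + 1 .. x * ln x - x + ln x + 1}"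
      "ln (fact (n div 2)) \<in> {(x/2) * ln (x/2) - x/2 - ln (x/2) + 1 .. (x/2) * ln (x/2) - x/2 + ln (x/2) + 1}"
      "ln (fact (n div 3)) \<in> {(x/3) * ln (x/3) - x/3 - ln (x/3) + 1 .. (x/3) * ln (x/3) - x/3 + ln (x/3) + 1}"
      "ln (fact (n div 5)) \<in> {(x/5) * ln (x/5) - x/5 - ln (x/5) + 1 .. (x/5) * ln (x/5) - x/5 + ln (x/5) + 1}"
      "ln (fact (n div 30)) \<in> {(x/30) * ln (x/30) - x/30 - ln (x/30) + 1 .. (x/30) * ln (x/30) - x/30 + ln (x/30) + 1}"
    using ln_fact_div_bounds[of 1 n] ln_fact_div_bounds[of 2 n] ln_fact_div_bounds[of 3 n]
      ln_fact_div_bounds[of 5 n] ln_fact_div_bounds[of 30 n] assms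
    by (simp_all add: x_def)
  define c where "c = (14 * ln 2 + 9 * ln 3 + 5 * ln 5) / (30::real)"
  have c: "0.9209 < c" "c < 0.9214" using ln_2_approx ln_3_approx ln_5_approx by (auto simp: c_def)
  have cx: "0.9209 * x \<le> c * x" "c * x \<le> 0.9214 * x" using c x by auto
  have "x * ln x - (x/2) * ln (x/2) - (x/3) * ln (x/3) - (x/5) * ln (x/5) + (x/30) * ln (x/30) = c * x"
    using x by (simp add: ln_div l c_def field_simps)
  hence "chebyshev_quot n \<ge> c * x - 5 * ln x + 2 * ln 30 - 1"
    "chebyshev_quot n \<le> c * x + 5 * ln x - 2 * ln 30 - 1"
    using * x unfolding chebyshev_quot_def by (auto simp: ln_div l)
  thus "chebyshev_quot n \<ge> 0.9209 * n - 5 * ln n + 5.7"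
    "chebyshev_quot n \<le> 0.9214 * n + 5 * ln n - 7.7"
    using cx ln_2_approx ln_3_approx ln_5_approx unfolding l x_def by auto
qed

text \<open>Base cases for \<open>psi_le\<close>. Chebyshev's quotient is the logarithm of an
  explicit rational number, so each claim becomes a comparison with a power of 2; \<open>a\<close>
  bounds \<open>exp (psi (n div 6))\<close>.\<close>

lemma psi_le_small: "psi 3 \<le> 3 * ln 2" "psi 7 \<le> 9 * ln 2" "psi 16 \<le> 21 * ln 2" "psi 22 \<le> 31 * ln 2"
  "psi 29 \<le> 46 * ln 2"
proof -
  have ln_le: "ln x \<le> real k * ln 2" if "0 < x" "x \<le> 2 ^ k" for x :: real and k
    using that by (metis ln_realpow ln_mono zero_less_numeral zero_less_power)
  have psi_le: "psi n \<le> real k * ln 2"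
    if "psi (n div 6) \<le> ln a" "0 < a" "a * (fact n * fact (n div 30) / (fact (n div 2) * fact (n div 3) * fact (n div 5))) \<le> 2 ^ k"
    for n k a
  proof -
    let ?b = "fact n * fact (n div 30) / (fact (n div 2) * fact (n div 3) * fact (n div 5)) :: real"
    have "chebyshev_quot n = ln ?b"
      by (simp add: chebyshev_quot_def ln_mult ln_div)
    moreover have "ln (a * ?b) = ln a + ln ?b" using that by (subst ln_mult) (auto simp del: times_divide_eq_right)
    ultimately have "psi n \<le> ln (a * ?b)"
      using psi_le_chebyshev_quot[of n] that by linarith
    also have "\<dots> \<le> real k * ln 2" using that by (intro ln_le) auto
    finally show ?thesis .
  qed
  have psi1: "psi (Suc 0) = 0" by (simp add: psi_def)
  have 2: "psi 2 \<le> ln 2" and 4: "psi 4 \<le> 4 * ln 2"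
    using psi_le[of 2 1 1] psi_le[of 4 1 4] by (simp_all add: fact_numeral)
  show "psi 7 \<le> 9 * ln 2" using psi_le[of 7 1 9] psi1 by (simp add: fact_numeral)
  show "psi 16 \<le> 21 * ln 2" using psi_le[of 16 2 21] 2 by (simp add: fact_numeral)
  show psi3: "psi 3 \<le> 3 * ln 2" using psi_le[of 3 1 3] by (simp add: fact_numeral)
  show "psi 22 \<le> 31 * ln 2" using psi_le[of 22 8 31] psi3 ln_realpow[of 2 3] by (simp add: fact_numeral)
  show "psi 29 \<le> 46 * ln 2" using psi_le[of 29 16 46] 4 ln_realpow[of 2 4] by (simp add: fact_numeral)
qed

text \<open>Iterating \<open>\<psi>(n) \<le> \<psi>(n / 6) + 0.9214 n + O(ln n)\<close> gives the
  slope \<open>0.9214 * 6 / 5 < 1.106\<close>; the term \<open>3 * sqrt n\<close> absorbs the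
  logarithms.\<close>

lemma psi_le: "psi n \<le> 1.106 * n + 3 * sqrt n"
proof (induction n rule: less_induct)
  case (less n)
  have ln2: "ln 2 < (0.6932::real)" using ln_2_approx by simp
  \<comment> \<open>For \<open>n < 30\<close>: \<open>m\<close> is the right end of an interval
    containing \<open>n\<close>, and \<open>l\<close> a lower estimate for the square root of its
    left end.\<close>
  have base: "psi n \<le> 1.106 * n + 3 * sqrt n"
    if "n \<le> m" "psi m \<le> c * ln 2" "l\<^sup>2 \<le> n" "0.6932 * c \<le> 1.106 * l\<^sup>2 + 3 * l" "c \<ge> 0" "l \<ge> 0" for m and c l :: real
  proof -
    have "l \<le> sqrt n" using that by (simp add: real_le_rsqrt)
    have "psi n \<le> psi m" using that by (intro psi_mono)
    also have "\<dots> \<le> 0.6932 * c" using that ln2 mult_left_mono[of "ln 2" "0.6932" c] by simp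
    also have "\<dots> \<le> 1.106 * l\<^sup>2 + 3 * l" by fact
    also have "\<dots> \<le> 1.106 * n + 3 * sqrt n" using that \<open>l \<le> sqrt n\<close> by simp
    finally show ?thesis .
  qed
  show ?case
  proof (cases "n < 30")
    case True
    consider "n = 0" | "1 \<le> n" "n \<le> 3" | "4 \<le> n" "n \<le> 7" | "8 \<le> n" "n \<le> 16" | "17 \<le> n" "n \<le> 22" | "23 \<le> n" "n \<le> 29"
      using True by linarith
    thus ?thesis
    proof cases
      case 2 thus ?thesis using base[of 3 3 1] psi_le_small by simp
    next
      case 3 thus ?thesis using base[of 7 9 2] psi_le_small by simp
    next
      case 4 thus ?thesis using base[of 16 21 "2.8"] psi_le_small by (simp add: power2_eq_square)
    next
      case 5 thus ?thesis using base[of 22 31 4] psi_le_small by simp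
    next
      case 6 thus ?thesis using base[of 29 46 "4.7"] psi_le_small by (simp add: power2_eq_square)
    qed auto
  next
    case False
    define s where "s = sqrt n"
    have s: "s\<^sup>2 = n" by (simp add: s_def)
    have "5.4 < s" unfolding s_def using False by (intro real_less_rsqrt) (simp add: power2_eq_square)
    note s = this s
    \<comment> \<open>\<open>0.4083\<close> is just above \<open>1 / sqrt 6\<close>.\<close>
    have "sqrt (n div 6) \<le> 0.4083 * s"
    proof (rule real_le_lsqrt)
      have "real (n div 6) \<le> n / 6" using of_nat_div_le_of_nat[of n 6] by simp
      also have "\<dots> \<le> (0.4083 * s)\<^sup>2" using s by (simp add: power_mult_distrib power2_eq_square)
      finally show "real (n div 6) \<le> (0.4083 * s)\<^sup>2" .
    qed (use s in auto)
    moreover have "real (n div 6) \<le> n / 6" using of_nat_div_le_of_nat[of n 6] by simp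
    moreover have "psi (n div 6) \<le> 1.106 * (n div 6) + 3 * sqrt (n div 6)"
      using False by (intro less.IH) auto
    ultimately have *: "psi (n div 6) \<le> 1.106 * (n / 6) + 3 * (0.4083 * s)" by simp
    \<comment> \<open>The tangent of \<open>ln\<close> at 6 bounds
      \<open>5 * ln n = 10 * ln s\<close> with slope \<open>10 / 6\<close> in \<open>s\<close>,
      below the available \<open>3 * (1 - 0.4083)\<close>.\<close>
    have "ln (s / 6) \<le> s / 6 - 1" using s by (intro ln_le_minus_one) auto
    moreover have "ln (6::real) = ln 2 + ln 3" using ln_mult[of 2 3] by simp
    moreover have "ln n = 2 * ln s" using s(1) s(2)[symmetric] by (simp add: ln_realpow)
    ultimately have "5 * ln n \<le> 10 * (s / 6 - 1 + 0.6932 + 1.0987)"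
      using ln_2_approx ln_3_approx s by (simp add: ln_div)
    moreover have "psi n \<le> psi (n div 6) + (0.9214 * n + 5 * ln n - 7.7)"
      using psi_le_chebyshev_quot[of n] chebyshev_quot_bounds[of n] False by linarith
    ultimately show ?thesis using * s unfolding s_def[symmetric] by simp
  qed
qed

section \<open>Chebyshev's function \<theta> and its distance from \<psi>\<close>

definition theta :: "nat \<Rightarrow> real" where
  "theta n = (\<Sum>p | prime p \<and> p \<le> n. ln (real p))"

text \<open>Every higher prime power is \<open>q\<^sup>2\<close> or \<open>p q\<^sup>2\<close> for a power \<open>q \<le> \<surd>n\<close> of the same prime \<open>p\<close>.\<close>
lemma sum_mangoldt_nonprime_le:
  "(\<Sum>d | d \<in> {1..n} \<and> primepow d \<and> \<not> prime d. mangoldt d) \<le> 2 * psi (floor_sqrt n)"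
proof -
  define N where "N = {d. d \<in> {1..n} \<and> primepow d \<and> \<not> prime d}"
  define Q where "Q = {q. q \<in> {1..floor_sqrt n} \<and> primepow q}"
  define f where "f = (\<lambda>q::nat. q ^ 2)"
  define g where "g = (\<lambda>q::nat. aprimedivisor q * q ^ 2)"
  have "N \<subseteq> f ` Q \<union> g ` Q"
  proof
    fix d assume d: "d \<in> N"
    then obtain p j where p: "prime p" "d = p ^ j" "j > 0"
      by (auto simp: N_def primepow_def)
    hence "j \<noteq> 1" using d by (auto simp: N_def)
    define q where "q = p ^ (j div 2)"
    have j2: "j div 2 > 0" using \<open>j > 0\<close> \<open>j \<noteq> 1\<close> by auto
    have q: "primepow q" "aprimedivisor q = p"
      using p j2 by (auto simp: q_def aprimedivisor_prime_power)
    have "q ^ 2 \<le> d" unfolding q_def p(2) power_mult[symmetric]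
      using p by (intro power_increasing) (auto simp: prime_ge_Suc_0_nat)
    hence "q \<in> Q" using d q primepow_gt_0_nat[of q] by (auto simp: Q_def N_def le_floor_sqrt_iff)
    moreover have "d = f q \<or> d = g q"
    proof (cases "even j")
      case True thus ?thesis by (auto simp: f_def q_def p power_mult[symmetric])
    next
      case False
      hence "j = Suc (j div 2 * 2)" by presburger
      hence "d = p * (p ^ (j div 2)) ^ 2" using p(2) by (metis power_Suc power_mult)
      thus ?thesis using q by (auto simp: g_def q_def)
    qed
    ultimately show "d \<in> f ` Q \<union> g ` Q" by auto
  qed
  moreover have fin: "finite Q" by (auto simp: Q_def)
  ultimately have "sum mangoldt N \<le> (sum mangoldt (f ` Q \<union> g ` Q) :: real)"
    by (intro sum_mono2) (auto simp: mangoldt_nonneg)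
  also have "\<dots> \<le> sum mangoldt (f ` Q) + sum mangoldt (g ` Q)"
    using fin by (simp add: sum_Un sum_nonneg mangoldt_nonneg)
  also have "\<dots> \<le> sum (mangoldt \<circ> f) Q + sum (mangoldt \<circ> g) Q"
    using fin by (intro add_mono sum_image_le) (auto simp: mangoldt_nonneg)
  also have "sum (mangoldt \<circ> f) Q = (\<Sum>q\<in>Q. mangoldt q :: real)"
  proof (intro sum.cong refl)
    fix q assume "q \<in> Q"
    then obtain p j where p: "prime p" "q = p ^ j" "j > 0"
      by (auto simp: Q_def primepow_def)
    thus "(mangoldt \<circ> f) q = (mangoldt q :: real)" by (simp add: f_def power_mult[symmetric])
  qed
  also have "sum (mangoldt \<circ> g) Q = (\<Sum>q\<in>Q. mangoldt q :: real)"
  proof (intro sum.cong refl)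
    fix q assume "q \<in> Q"
    then obtain p j where p: "prime p" "q = p ^ j" "j > 0"
      by (auto simp: Q_def primepow_def)
    have "g q = p ^ Suc (j * 2)"
      using p by (simp add: g_def aprimedivisor_prime_power power_mult[symmetric])
    thus "(mangoldt \<circ> g) q = (mangoldt q :: real)" using p by (simp del: power_Suc)
  qed
  also have "(\<Sum>q\<in>Q. mangoldt q) \<le> psi (floor_sqrt n)"
    unfolding psi_def Q_def by (intro sum_mono2) (auto simp: mangoldt_nonneg)
  finally show ?thesis by (simp add: N_def)
qed

lemma theta_le_psi: "theta n \<le> psi n"
proof -
  have "theta n = (\<Sum>p | prime p \<and> p \<le> n. mangoldt p)"
    unfolding theta_def by (intro sum.cong) auto
  also have "\<dots> \<le> psi n" unfolding psi_def
    by (intro sum_mono2) (auto simp: mangoldt_nonneg prime_ge_Suc_0_nat)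
  finally show ?thesis .
qed

lemma psi_le_theta: "psi n \<le> theta n + 2 * psi (floor_sqrt n)"
proof -
  have "psi n = (\<Sum>d | d \<in> {1..n} \<and> primepow d. mangoldt d)"
    unfolding psi_def by (intro sum.mono_neutral_right) (auto simp: mangoldt_def)
  also have "{d. d \<in> {1..n} \<and> primepow d} =
      {p. prime p \<and> p \<le> n} \<union> {d. d \<in> {1..n} \<and> primepow d \<and> \<not> prime d}"
    by (auto simp: prime_ge_Suc_0_nat)
  also have "(\<Sum>d\<in>\<dots>. mangoldt d) =
      (\<Sum>p | prime p \<and> p \<le> n. mangoldt p) + (\<Sum>d | d \<in> {1..n} \<and> primepow d \<and> \<not> prime d. mangoldt d)"
    by (intro sum.union_disjoint) auto
  also have "(\<Sum>p | prime p \<and> p \<le> n. mangoldt p) = theta n"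
    unfolding theta_def by (intro sum.cong) auto
  finally show ?thesis using sum_mangoldt_nonprime_le[of n] by simp
qed

section \<open>Prime factorization and size of binomial coefficients\<close>

lemma ln_choose_eq_sum_mangoldt:
  assumes "k \<le> n"
  shows "ln (n choose k) = (\<Sum>d=1..n. mangoldt d * real (n div d - k div d - (n - k) div d))"
proof -
  have "real (n choose k) = fact n / (fact k * fact (n - k))"
    using assms by (simp add: binomial_fact)
  hence "ln (n choose k) = ln (fact n) - ln (fact k) - ln (fact (n - k))"
    by (simp add: ln_mult ln_div)
  also have "\<dots> = (\<Sum>d=1..n. mangoldt d * (real (n div d) - real (k div d) - real ((n - k) div d)))"
    using assms ln_fact_eq_sum_mangoldt[of n n] ln_fact_eq_sum_mangoldt[of k n] ln_fact_eq_sum_mangoldt[of "n - k" n]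
    by (simp add: sum_subtractf[symmetric] algebra_simps)
  also have "\<dots> = (\<Sum>d=1..n. mangoldt d * real (n div d - k div d - (n - k) div d))"
  proof (intro sum.cong refl)
    fix d
    have "k div d + (n - k) div d \<le> n div d"
      using assms div_add1_eq[of k "n - k" d] by simp
    thus "mangoldt d * (real (n div d) - real (k div d) - real ((n - k) div d)) =
          mangoldt d * real (n div d - k div d - (n - k) div d)" by simp
  qed
  finally show ?thesis .
qed

text \<open>Every coefficient in the expansion is 0 or 1. It vanishes at a prime
  \<open>d > y\<close>, because the largest multiple of \<open>d\<close> up to \<open>n\<close> is
  then at most \<open>n - k\<close>. There remain primes up to \<open>y\<close> and higher prime
  powers up to \<open>n\<close>.\<close>

lemma ln_choose_le_psi:
  assumes "k \<le> n" and smooth: "\<And>p m. prime p \<Longrightarrow> y < p \<Longrightarrow> n - k < m \<Longrightarrow> m \<le> n \<Longrightarrow> \<not> p dvd m"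
  shows "ln (n choose k) \<le> psi y + 2 * psi (floor_sqrt n)"
proof -
  have "ln (n choose k) \<le> (\<Sum>d=1..n. (if prime d \<and> d \<le> y then mangoldt d else 0) +
           (if primepow d \<and> \<not> prime d then mangoldt d else 0))"
    unfolding ln_choose_eq_sum_mangoldt[OF \<open>k \<le> n\<close>]
  proof (intro sum_mono)
    fix d assume d: "d \<in> {1..n}"
    let ?c = "n div d - k div d - (n - k) div d"
    have "?c \<le> 1"
    proof -
      have "(k mod d + (n - k) mod d) div d < 2"
        using d by (intro less_mult_imp_div_less) (auto intro!: add_less_mono simp: mult_2)
      thus ?thesis using assms div_add1_eq[of k "n - k" d] by simp
    qed
    hence le: "mangoldt d * real ?c \<le> mangoldt d"
      using mult_left_mono[of "real ?c" 1 "mangoldt d"] mangoldt_nonneg by simp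
    have "?c = 0" if "prime d" "y < d"
    proof -
      have "n div d * d \<le> n - k"
        using smooth[OF that, of "n div d * d"] by (meson div_times_less_eq_dividend dvd_triv_right not_le)
      hence "n div d \<le> (n - k) div d"
        using d by (simp add: less_eq_div_iff_mult_less_eq)
      thus ?thesis by simp
    qed
    thus "mangoldt d * real ?c \<le> (if prime d \<and> d \<le> y then mangoldt d else 0) +
             (if primepow d \<and> \<not> prime d then mangoldt d else (0::real))"
      using le by (cases "primepow d") (auto simp: mangoldt_def)
  qed
  also have "\<dots> = (\<Sum>p | p \<in> {1..n} \<and> prime p \<and> p \<le> y. mangoldt p) +
      (\<Sum>d | d \<in> {1..n} \<and> primepow d \<and> \<not> prime d. mangoldt d)"
    by (simp only: sum.distrib sum.inter_filter[symmetric] finite_atLeastAtMost)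
  also have "(\<Sum>p | p \<in> {1..n} \<and> prime p \<and> p \<le> y. mangoldt p) \<le> psi y"
    unfolding psi_def by (intro sum_mono2) (auto simp: mangoldt_nonneg)
  finally show ?thesis using sum_mangoldt_nonprime_le[of n] by simp
qed

lemma power_mult_fact_le: "(m + 1) ^ k * fact m \<le> (fact (m + k) :: nat)"
proof (induction k)
  case (Suc k)
  have "(m + 1) ^ Suc k * fact m = (m + 1) * ((m + 1) ^ k * fact m)" by (simp add: algebra_simps)
  also have "\<dots> \<le> (m + 1 + k) * fact (m + k)" by (intro mult_mono Suc) auto
  finally show ?case by simp
qed auto

text \<open>Each of the \<open>k\<close> factors of \<open>n * (n - 1) * ... * (n - k + 1)\<close>
  is at least \<open>n - k + 1\<close>, and the denominator \<open>fact k\<close> is bounded by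
  Stirling.\<close>

lemma ln_choose_ge:
  assumes "1 \<le> k" "k \<le> n"
  shows "ln (n choose k) \<ge> k * ln (real (n - k + 1) / k) + k - ln k - 1"
proof -
  have "(n - k + 1) ^ k * fact (n - k) \<le> (fact n :: nat)"
    using power_mult_fact_le[of "n - k" k] assms by simp
  also have "\<dots> = (fact k * (n choose k)) * fact (n - k)"
    using binomial_fact_lemma[OF assms(2)] by (simp add: mult_ac)
  finally have "(n - k + 1) ^ k \<le> fact k * (n choose k)" by simp
  hence "real ((n - k + 1) ^ k) \<le> real (fact k * (n choose k))"
    by (simp only: of_nat_le_iff)
  hence "ln (real (n - k + 1) ^ k) \<le> ln (fact k * real (n choose k))"
    by (intro ln_mono) auto
  hence "k * ln (real (n - k + 1)) \<le> ln (fact k) + ln (n choose k)"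
    using assms by (simp add: ln_realpow ln_mult del: of_nat_Suc of_nat_add)
  moreover have "ln (real (n - k + 1) / k) = ln (real (n - k + 1)) - ln k"
    using assms by (subst ln_div) auto
  ultimately show ?thesis using ln_fact_le[OF assms(1)] by (simp only: right_diff_distrib)
qed

text \<open>Without a prime, \<open>theta\<close> would not grow from \<open>m \<le> 0.8 * n\<close>
  to \<open>n\<close>, but \<open>0.9209 > 0.8 * 1.106 = 0.8848\<close>. From
  \<open>n = 200^2\<close> on, the lower-order terms do not matter.\<close>

lemma ex_prime_in_fifth:
  fixes n k :: nat
  assumes "40000 \<le> n" "n \<le> 5 * k"
  shows "\<exists>p. prime p \<and> n - k < p \<and> p \<le> n"
proof (rule ccontr)
  assume no: "\<not> ?thesis"
  define m where "m = n - k"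
  have m: "real m \<le> 0.8 * n" "m \<le> n" using assms by (auto simp: m_def)
  define r where "r = sqrt n"
  have r: "r \<ge> 200" "r\<^sup>2 = n" using assms by (auto simp: r_def intro!: real_le_rsqrt)
  have "{p. prime p \<and> p \<le> n} = {p. prime p \<and> p \<le> m}"
    using no m by (auto simp: m_def not_less)
  hence "theta n = theta m" by (simp add: theta_def)
  hence 1: "psi n \<le> psi m + 2 * psi (floor_sqrt n)"
    using psi_le_theta[of n] theta_le_psi[of m] by simp
  have 2: "psi n \<ge> 0.9209 * n - 5 * ln n + 5.7"
    using chebyshev_quot_bounds[of n] chebyshev_quot_le_psi[of n] assms by simp
  \<comment> \<open>\<open>0.8945\<close> is just above \<open>sqrt 0.8\<close>.\<close>
  have "sqrt m \<le> 0.8945 * r"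
    using m r by (intro real_le_lsqrt) (auto simp: power_mult_distrib power_divide)
  hence 3: "psi m \<le> 1.106 * (0.8 * r\<^sup>2) + 3 * (0.8945 * r)"
    using psi_le[of m] m r by simp
  have "real (floor_sqrt n) \<le> r"
    using floor_sqrt_power2_le[of n] unfolding r_def by (intro real_le_rsqrt) (metis of_nat_le_iff of_nat_power)
  moreover have "sqrt (floor_sqrt n) \<le> r / 14"
  proof (rule real_le_lsqrt)
    have "r * 196 \<le> r\<^sup>2" unfolding power2_eq_square using r by (intro mult_left_mono) auto
    thus "real (floor_sqrt n) \<le> (r / 14)\<^sup>2" using calculation by (simp add: power_divide)
  qed (use r in auto)
  ultimately have 4: "psi (floor_sqrt n) \<le> 1.106 * r + 3 * (r / 14)"
    using psi_le[of "floor_sqrt n"] by simp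
  have "ln (r / 200) \<le> r / 200 - 1" using r by (intro ln_le_minus_one) auto
  moreover have "ln (200::real) = 3 * ln 2 + 2 * ln 5" 
    using ln_mult[of 8 25] ln_realpow[of 2 3] ln_realpow[of 5 2] by simp
  moreover have "ln n = 2 * ln r" using r(1) r(2)[symmetric] by (simp add: ln_realpow)
  ultimately have 5: "5 * ln n \<le> 10 * (r / 200 - 1 + 5.3)"
    using ln_2_approx ln_5_approx r by (simp add: ln_div)
  have "0.0361 * r\<^sup>2 \<le> 5.376 * r + 38" using 1 2 3 4 5 r(2) by simp
  moreover have "200 * r \<le> r\<^sup>2" unfolding power2_eq_square using r by (intro mult_right_mono) auto
  ultimately show False using r(1) by simp
qed

section \<open>Windows without large prime factors\<close>

text \<open>The distances from \<open>a\<close> to the numbers on its left and on its right form two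
  factorials whose arguments add up to \<open>k - 1\<close>.\<close>

lemma prod_dist_dvd_fact:
  fixes a m k :: nat
  assumes "a \<in> {m<..m+k}"
  shows "(\<Prod>x\<in>{m<..m+k}-{a}. if x < a then a - x else x - a) dvd fact (k - 1)"
proof -
  have "{m<..m+k}-{a} = {m<..<a} \<union> {a<..m+k}" using assms by auto
  hence "(\<Prod>x\<in>{m<..m+k}-{a}. if x < a then a - x else x - a) =
      (\<Prod>x\<in>{m<..<a}\<union>{a<..m+k}. if x < a then a - x else x - a)" by simp
  also have "\<dots> =
      (\<Prod>x\<in>{m<..<a}. if x < a then a - x else x - a) * (\<Prod>x\<in>{a<..m+k}. if x < a then a - x else x - a)"
    by (rule prod.union_disjoint) auto
  also have "(\<Prod>x\<in>{m<..<a}. if x < a then a - x else x - a) = \<Prod>{1..a - m - 1}"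
    by (rule prod.reindex_bij_witness[of _ "\<lambda>x. a - x" "\<lambda>x. a - x"]) auto
  also have "(\<Prod>x\<in>{a<..m+k}. if x < a then a - x else x - a) = \<Prod>{1..m + k - a}"
    by (rule prod.reindex_bij_witness[of _ "\<lambda>x. x + a" "\<lambda>x. x - a"]) auto
  also have "\<Prod>{1..a - m - 1} * \<Prod>{1..m + k - a} = fact (a - m - 1) * fact (m + k - a)"
    by (simp only: fact_prod of_nat_id)
  also have "\<dots> dvd fact ((a - m - 1) + (m + k - a))" by (rule fact_fact_dvd_fact)
  also have "(a - m - 1) + (m + k - a) = k - 1" using assms by simp
  finally show ?thesis .
qed

lemma power_multiplicity_dvd_diff:
  fixes a x p :: nat
  assumes "multiplicity p x \<le> multiplicity p a"
  shows "p ^ multiplicity p x dvd a - x" "p ^ multiplicity p x dvd x - a"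
proof -
  note dvds = multiplicity_dvd[of p x] multiplicity_dvd'[OF assms]
  show "p ^ multiplicity p x dvd a - x" "p ^ multiplicity p x dvd x - a"
    by (fact dvd_diff_nat[OF dvds(2,1)], fact dvd_diff_nat[OF dvds])
qed

text \<open>Both \<open>x\<close> and \<open>a\<close> are divisible by
  \<open>p ^ multiplicity p x\<close>, hence so is their distance. So the valuation of the product
  is at most that of the product of all distances to \<open>a\<close>, a divisor of
  \<open>fact (k - 1)\<close>.\<close>

lemma multiplicity_prod_remove_max_le:
  fixes a m k p :: nat
  assumes p: "prime p" and a: "a \<in> {m<..m+k}"
    and max: "\<And>x. x \<in> {m<..m+k} \<Longrightarrow> multiplicity p x \<le> multiplicity p a"
  shows "multiplicity p (\<Prod>({m<..m+k}-{a})) \<le> multiplicity p (fact (k - 1) :: nat)"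
proof -
  let ?d = "\<lambda>x. if x < a then a - x else x - a"
  have "multiplicity p (\<Prod>({m<..m+k}-{a})) = (\<Sum>x\<in>{m<..m+k}-{a}. multiplicity p x)"
    using p by (subst prime_elem_multiplicity_prod_distrib) auto
  also have "\<dots> \<le> (\<Sum>x\<in>{m<..m+k}-{a}. multiplicity p (?d x))"
  proof (intro sum_mono)
    fix x assume x: "x \<in> {m<..m+k}-{a}"
    have "p ^ multiplicity p x dvd ?d x"
      using power_multiplicity_dvd_diff[of p x a] max[of x] x by auto
    thus "multiplicity p x \<le> multiplicity p (?d x)"
      using x p by (intro multiplicity_geI) (auto dest: prime_gt_1_nat)
  qed
  also have "\<dots> = multiplicity p (\<Prod>x\<in>{m<..m+k}-{a}. ?d x)"
    using p by (subst prime_elem_multiplicity_prod_distrib) auto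
  also have "\<dots> \<le> multiplicity p (fact (k - 1) :: nat)"
    by (intro dvd_imp_multiplicity_le prod_dist_dvd_fact a) auto
  finally show ?thesis .
qed

section \<open>Smooth windows and the bound by a factorial\<close>

definition smooth_window :: "nat \<Rightarrow> nat \<Rightarrow> bool" where
  "smooth_window m k \<longleftrightarrow> (\<forall>p x. prime p \<longrightarrow> x \<in> {m<..m+k} \<longrightarrow> p dvd x \<longrightarrow> p \<le> 2 * k)"

definition prime_count :: "nat \<Rightarrow> nat" where
  "prime_count x = card {p. prime p \<and> p \<le> x}"

lemma finite_primes_le [simp]: "finite {p::nat. prime p \<and> p \<le> x}"
  by (rule finite_subset[of _ "{..x}"]) auto

text \<open>\<open>own p\<close> picks a number of the window with largest \<open>p\<close>-adic
  valuation; several primes may share one owner. For primes up to \<open>2 * k\<close> removing the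
  owner suffices, and larger primes divide no number of the window.\<close>

lemma smooth_window_owners:
  assumes "smooth_window m k" "k > 0"
  shows "\<exists>own. (\<forall>p. own p \<in> {m<..m+k} \<and> (\<forall>x\<in>{m<..m+k}. multiplicity p x \<le> multiplicity p (own p))) \<and>
    \<Prod>({m<..m+k} - own ` {p. prime p \<and> p \<le> 2 * k}) dvd fact (k - 1)"
proof -
  let ?S = "{m<..m+k}" and ?P = "{p::nat. prime p \<and> p \<le> 2 * k}"
  have "\<exists>a\<in>?S. \<forall>x\<in>?S. multiplicity p x \<le> multiplicity p a" for p
  proof -
    have "finite (multiplicity p ` ?S)" "multiplicity p ` ?S \<noteq> {}" using assms by auto
    then obtain a where "a \<in> ?S" "Max (multiplicity p ` ?S) = multiplicity p a"
      using Max_in[of "multiplicity p ` ?S"] by blast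
    thus ?thesis using Max_ge[of "multiplicity p ` ?S"] by (intro bexI[of _ a]) auto
  qed
  then have "\<exists>own. \<forall>p. own p \<in> ?S \<and> (\<forall>x\<in>?S. multiplicity p x \<le> multiplicity p (own p))"
    by (intro choice) blast
  then obtain own where own: "\<And>p. own p \<in> ?S"
    "\<And>p x. x \<in> ?S \<Longrightarrow> multiplicity p x \<le> multiplicity p (own p)"
    by blast
  let ?R = "?S - own ` ?P"
  have "\<Prod>?R dvd fact (k - 1)"
  proof (rule multiplicity_le_imp_dvd)
    show "\<Prod>?R \<noteq> 0" by auto
    fix p :: nat assume p: "prime p"
    show "multiplicity p (\<Prod>?R) \<le> multiplicity p (fact (k - 1))"
    proof (cases "p \<le> 2 * k")
      case True
      hence "?R \<subseteq> ?S - {own p}" using p by auto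
      hence "\<Prod>?R dvd \<Prod>(?S - {own p})" by (intro prod_dvd_prod_subset) auto
      hence "multiplicity p (\<Prod>?R) \<le> multiplicity p (\<Prod>(?S - {own p}))"
        by (intro dvd_imp_multiplicity_le) auto
      also have "\<dots> \<le> multiplicity p (fact (k - 1) :: nat)"
        by (intro multiplicity_prod_remove_max_le p own)
      finally show ?thesis .
    next
      case False
      hence "\<not> p dvd \<Prod>?R"
        using p assms(1) by (auto simp: prime_dvd_prod_iff smooth_window_def)
      thus ?thesis by (simp add: not_dvd_imp_multiplicity_0)
    qed
  qed
  thus ?thesis using own by blast
qed

lemma smooth_window_power_le:
  assumes "smooth_window m k" "k > 0"
  shows "(m + 1) ^ (k - prime_count (2 * k)) \<le> fact (k - 1)"
proof -
  obtain own where own: "\<Prod>({m<..m+k} - own ` {p. prime p \<and> p \<le> 2 * k}) dvd fact (k - 1)"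
    using smooth_window_owners[OF assms] by blast
  let ?R = "{m<..m+k} - own ` {p. prime p \<and> p \<le> 2 * k}"
  have "card (own ` {p. prime p \<and> p \<le> 2 * k}) \<le> prime_count (2 * k)"
    unfolding prime_count_def by (intro card_image_le) auto
  hence "k - prime_count (2 * k) \<le> card ?R"
    using diff_card_le_card_Diff[of "own ` {p. prime p \<and> p \<le> 2 * k}" "{m<..m+k}"] by simp
  hence "(m + 1) ^ (k - prime_count (2 * k)) \<le> (m + 1) ^ card ?R"
    by (intro power_increasing) auto
  also have "\<dots> = (\<Prod>x\<in>?R. m + 1)" by simp
  also have "\<dots> \<le> \<Prod>?R" by (intro prod_mono) auto
  also have "\<dots> \<le> fact (k - 1)" using own by (intro dvd_imp_le) auto
  finally show ?thesis .
qed

text \<open>Even numbers above 2 are not prime. Consequently the exponent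
  \<open>k - prime_count (2 * k)\<close> of \<open>smooth_window_power_le\<close> does not decrease
  as \<open>k\<close> grows.\<close>

lemma prime_count_even_le: "k > 0 \<Longrightarrow> prime_count (2 * k + 2 * j) \<le> prime_count (2 * k) + j"
proof (induction j)
  case (Suc j)
  have "\<not> prime (2 * (k + Suc j))"
    using Suc.prems prime_product[of 2 "k + Suc j"] by auto
  hence ne: "p \<noteq> 2 * k + 2 * j + 2" if "prime p" for p
    using that by (auto simp: algebra_simps)
  have "{p. prime p \<and> p \<le> 2 * k + 2 * Suc j} \<subseteq>
      insert (2 * k + 2 * j + 1) {p. prime p \<and> p \<le> 2 * k + 2 * j}" (is "?A \<subseteq> insert ?x ?B")
  proof
    fix p assume "p \<in> ?A"
    thus "p \<in> insert ?x ?B" using ne[of p] by simp linarith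
  qed
  hence "card ?A \<le> card (insert ?x ?B)" by (rule card_mono[rotated]) simp
  also have "\<dots> \<le> Suc (card ?B)" by (simp add: card_insert_if)
  finally have "prime_count (2 * k + 2 * Suc j) \<le> Suc (prime_count (2 * k + 2 * j))"
    by (simp only: prime_count_def)
  thus ?case using Suc.IH Suc.prems by simp
qed auto

text \<open>One numerical check covers all \<open>k\<close> from \<open>a\<close> to
  \<open>b\<close>: the exponent is smallest at \<open>a\<close> and the factorial largest at
  \<open>b\<close>.\<close>

lemma smooth_window_less:
  assumes "smooth_window m k" "a \<le> k" "k \<le> b" "a > 0" "prime_count (2 * a) \<le> c" "fact (b - 1) < X ^ (a - c)"
  shows "m + 1 < X"
proof (rule ccontr)
  assume "\<not> m + 1 < X"
  hence X: "X \<le> m + 1" by simp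
  have "prime_count (2 * k) \<le> prime_count (2 * a) + (k - a)"
    using prime_count_even_le[of a "k - a"] assms by (simp add: algebra_simps)
  hence "a - c \<le> k - prime_count (2 * k)" using assms by simp
  hence "(m + 1) ^ (a - c) \<le> (m + 1) ^ (k - prime_count (2 * k))"
    by (intro power_increasing) auto
  hence "X ^ (a - c) \<le> (m + 1) ^ (k - prime_count (2 * k))"
    using power_mono[OF X, of "a - c"] by simp
  also have "\<dots> \<le> fact (k - 1)" using assms by (intro smooth_window_power_le) auto
  also have "\<dots> \<le> fact (b - 1)" using assms by (intro fact_mono_nat) auto
  finally show False using assms by simp
qed

text \<open>A prime above 7 is coprime to \<open>210 = 2 * 3 * 5 * 7\<close>, and only
  \<open>totient 210 = 48\<close> residues are. What matters later is
  \<open>4 * 48 \<le> 210\<close>, a density below 1/4.\<close>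

lemma prime_count_add_210_le:
  assumes "7 \<le> x"
  shows "prime_count (x + 210) \<le> prime_count x + 48"
proof -
  let ?P = "{p. prime p \<and> p \<le> x + 210} - {p. prime p \<and> p \<le> x}"
  have "inj_on (\<lambda>p. p mod 210) ?P"
  proof (rule inj_onI)
    fix p q :: nat assume "p \<in> ?P" "q \<in> ?P" "p mod 210 = q mod 210"
    hence "\<bar>int p - int q\<bar> < 210" and "int (p mod 210) = int (q mod 210)" by auto
    thus "p = q" using dvd_imp_le_int[of "int p - int q" 210] by (auto simp: mod_eq_dvd_iff zmod_int)
  qed
  hence "card ?P = card ((\<lambda>p. p mod 210) ` ?P)" by (simp add: card_image)
  also have "\<dots> \<le> card (totatives 210)"
  proof (intro card_mono subsetI)
    fix r assume "r \<in> (\<lambda>p. p mod 210) ` ?P"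
    then obtain p where "p \<in> ?P" and r: "r = p mod 210" by (rule imageE)
    hence p: "prime p" "7 < p" using assms by auto
    have "\<not> p dvd 2 * 3 * 5 * 7"
    proof
      assume "p dvd 2 * 3 * 5 * 7"
      hence "p dvd 2 \<or> p dvd 3 \<or> p dvd 5 \<or> p dvd 7"
        using p(1) by (metis prime_dvd_mult_nat)
      moreover have "\<not> p dvd q" if "q > 0" "q \<le> 7" for q
        using that p(2) by (intro nat_dvd_not_less) auto
      from this[of 2] this[of 3] this[of 5] this[of 7]
      have "\<not> p dvd 2" "\<not> p dvd 3" "\<not> p dvd 5" "\<not> p dvd 7" by simp_all
      ultimately show False by blast
    qed
    hence "coprime p 210" using p(1) by (intro prime_imp_coprime) auto
    hence "coprime r 210" unfolding r by simp
    moreover from this have "r \<noteq> 0" by (intro notI) simp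
    ultimately show "r \<in> totatives 210" unfolding r by (simp add: totatives_def less_imp_le)
  qed simp
  also have "card (totatives 210) = totient (2 * (3 * (5 * 7)))" by (simp add: totient_def)
  also have "\<dots> = totient 2 * (totient 3 * (totient 5 * totient 7))"
  proof -
    have "coprime 2 (3 * (5 * 7 :: nat))" "coprime 3 (5 * 7 :: nat)" "coprime 5 (7 :: nat)"
      by (rule prime_imp_coprime; simp)+
    thus ?thesis by (simp only: totient_mult_coprime)
  qed
  also have "\<dots> = 48" by (simp add: totient_prime del: One_nat_def)
  finally have "card ?P \<le> 48" .
  moreover have "prime_count (x + 210) = card (?P \<union> {p. prime p \<and> p \<le> x})"
    unfolding prime_count_def by (rule arg_cong[of _ _ card]) auto
  ultimately show ?thesis
    using card_Un_le[of ?P "{p. prime p \<and> p \<le> x}"] by (simp add: prime_count_def)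
qed

text \<open>With one factor \<open>fact j\<close> written backwards, \<open>i\<close> is paired with
  \<open>j + 1 - i\<close>, and the arithmetic-geometric mean inequality applies to each
  pair.\<close>

lemma power_mult_fact_square_le: "4 ^ j * (fact j)\<^sup>2 \<le> ((j + 1)\<^sup>2) ^ j" for j :: nat
proof -
  have "(fact j :: nat) = (\<Prod>i=1..j. j + 1 - i)"
    unfolding fact_prod of_nat_id by (subst prod.atLeastAtMost_rev) simp
  hence "4 ^ j * (fact j :: nat)\<^sup>2 = (\<Prod>i=1..j. 4) * ((\<Prod>i=1..j. i) * (\<Prod>i=1..j. j + 1 - i))"
    by (simp add: power2_eq_square fact_prod)
  also have "\<dots> = (\<Prod>i=1..j. 4 * (i * (j + 1 - i)))"
    by (simp only: prod.distrib)
  also have "\<dots> \<le> (\<Prod>i=1..j. (j + 1)\<^sup>2)"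
  proof (intro prod_mono conjI)
    fix i assume "i \<in> {1..j}"
    then obtain l where l: "j + 1 = i + l" by (metis atLeastAtMost_iff le_add1 le_Suc_ex le_trans)
    have "int (4 * (i * l)) \<le> int ((i + l)\<^sup>2)"
      using zero_le_power2[of "int i - int l"] by (simp add: power2_eq_square algebra_simps)
    hence "4 * (i * l) \<le> (i + l)\<^sup>2" by (simp only: of_nat_le_iff)
    thus "4 * (i * (j + 1 - i)) \<le> (j + 1)\<^sup>2" unfolding l by simp
  qed auto
  finally show ?thesis by simp
qed

text \<open>The exponent \<open>k - prime_count (2 * k)\<close> is at least \<open>k / 2\<close>, so
  \<open>(m + 1) ^ k \<le> (fact (k - 1))\<^sup>2\<close>. If
  \<open>k\<^sup>2 \<le> 4 * (m + 1)\<close>, then \<open>power_mult_fact_square_le\<close> yields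
  \<open>k\<^sup>2 \<le> 4\<close>.\<close>

lemma smooth_window_less_square:
  assumes "smooth_window m k" "2 * prime_count (2 * k) \<le> k" "3 \<le> k"
  shows "4 * (m + 1) < k\<^sup>2"
proof (rule ccontr)
  assume "\<not> 4 * (m + 1) < k\<^sup>2"
  hence ge: "k\<^sup>2 \<le> 4 * (m + 1)" by simp
  define e where "e = k - prime_count (2 * k)"
  have e: "k \<le> e * 2" using assms by (simp add: e_def)
  have "k\<^sup>2 * (k\<^sup>2) ^ (k - 1) = (k\<^sup>2) ^ k"
    using assms by (simp flip: power_Suc)
  also have "\<dots> \<le> (4 * (m + 1)) ^ k" using ge by (rule power_mono) simp
  also have "\<dots> = 4 ^ k * (m + 1) ^ k" by (rule power_mult_distrib)
  also have "4 ^ k = 4 * (4::nat) ^ (k - 1)" using assms by (simp flip: power_Suc)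
  also have "(m + 1) ^ k \<le> ((m + 1) ^ e)\<^sup>2"
    unfolding power_mult[symmetric] using e by (intro power_increasing) auto
  also have "\<dots> \<le> (fact (k - 1))\<^sup>2"
    unfolding e_def using assms by (intro power_mono smooth_window_power_le) auto
  also have "4 * 4 ^ (k - 1) * (fact (k - 1))\<^sup>2 \<le> 4 * (k\<^sup>2) ^ (k - 1)"
    using power_mult_fact_square_le[of "k - 1"] assms by simp
  finally have "k\<^sup>2 \<le> 4" using assms by simp
  moreover have "3\<^sup>2 \<le> k\<^sup>2" using assms by (intro power_mono) auto
  ultimately show False by simp
qed

section \<open>Long smooth windows: bounds from binomial coefficients\<close>

lemma psi_floor_sqrt_le: "psi (floor_sqrt n) \<le> 1.106 * sqrt n + 3 * sqrt (sqrt n)"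
proof -
  have "real (floor_sqrt n) \<le> sqrt n"
    using floor_sqrt_power2_le[of n] by (intro real_le_rsqrt) (metis of_nat_le_iff of_nat_power)
  hence "1.106 * real (floor_sqrt n) + 3 * sqrt (floor_sqrt n) \<le> 1.106 * sqrt n + 3 * sqrt (sqrt n)"
    by (intro add_mono mult_left_mono real_sqrt_le_mono) auto
  with psi_le[of "floor_sqrt n"] show ?thesis by (rule order.trans)
qed

text \<open>Lower and upper bound for \<open>ln ((m + k) choose k)\<close> combined;
  \<open>2.212 = 2 * 1.106\<close> comes once from \<open>psi (2 * k)\<close> and once from
  \<open>2 * psi (floor_sqrt (m + k))\<close>.\<close>

lemma smooth_window_ineq:
  assumes "smooth_window m k" "1 \<le> k"
  shows "k * ln (real (m + 1) / k) + k - ln k - 1 \<le>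
    2.212 * k + 3 * sqrt (2 * k) + 2.212 * sqrt (m + k) + 6 * sqrt (sqrt (m + k))"
proof -
  have "k * ln (real (m + 1) / k) + k - ln k - 1 \<le> ln ((m + k) choose k)"
    using ln_choose_ge[of k "m + k"] assms by simp
  also have "\<dots> \<le> psi (2 * k) + 2 * psi (floor_sqrt (m + k))"
    using assms(1) by (intro ln_choose_le_psi) (auto simp: smooth_window_def not_le)
  finally show ?thesis using psi_le[of "2 * k"] psi_floor_sqrt_le[of "m + k"] by simp
qed

text \<open>The quadratic bound gives \<open>sqrt (m + k) \<le> k / 2 + 1\<close>, so the right side
  of \<open>smooth_window_ineq\<close> has slope \<open>2.212 + 2.212 / 2 = 3.318\<close> in
  \<open>k\<close>. If \<open>m + k \<ge> 30 * k\<close>, the left side has slope at least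
  \<open>1 + ln 29 > 4.36\<close>.\<close>

lemma smooth_window_less_30:
  assumes "smooth_window m k" "100 \<le> k" "4 * (m + 1) < k\<^sup>2"
  shows "m + k < 30 * k"
proof (rule ccontr)
  assume "\<not> ?thesis"
  hence mk: "29 * k \<le> m" by simp
  define r where "r = sqrt k"
  have r: "10 \<le> r" "r\<^sup>2 = k" using assms by (auto simp: r_def intro!: real_le_rsqrt)
  have "29 \<le> real (m + 1) / k" using mk assms by (simp add: field_simps)
  \<comment> \<open>A number just below 29 composed of 2, 3 and 5, whose logarithms are
    known.\<close>
  moreover have "28.8 = (2 ^ 4 * 3 ^ 2 / 5 :: real)" by simp
  moreover have "ln (2 ^ 4 * 3 ^ 2 / 5 :: real) = 4 * ln 2 + 2 * ln 3 - ln 5"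
    by (simp only: ln_mult ln_div ln_realpow) simp
  moreover have "ln 28.8 \<le> ln (real (m + 1) / k)"
    using order.trans[OF _ calculation(1), of "28.8"] by (intro ln_mono) auto
  ultimately have "3.36 \<le> ln (real (m + 1) / k)" using ln_2_approx ln_3_approx ln_5_approx by simp
  hence "3.36 * k \<le> ln (real (m + 1) / k) * k" by (rule mult_right_mono) simp
  hence 1: "3.36 * r\<^sup>2 \<le> k * ln (real (m + 1) / k)" unfolding r(2) by (simp only: mult.commute)
  have "ln (r / 10) \<le> r / 10 - 1" using r by (intro ln_le_minus_one) auto
  moreover have "ln (10::real) = ln 2 + ln 5" using ln_mult[of 2 5] by simp
  moreover have "ln k = 2 * ln r" using r(1) r(2)[symmetric] by (simp add: ln_realpow)
  ultimately have 2: "ln k \<le> 0.2 * r + 2.61"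
    using ln_2_approx ln_5_approx r by (simp add: ln_div)
  have "4 * real (m + 1) \<le> (real k)\<^sup>2" using assms(3) by (metis less_imp_le of_nat_le_iff of_nat_mult of_nat_numeral of_nat_power)
  hence "real (m + k) \<le> (k / 2 + 1)\<^sup>2" by (simp add: power2_eq_square field_simps)
  hence 3: "sqrt (m + k) \<le> r\<^sup>2 / 2 + 1" unfolding r(2) by (intro real_le_lsqrt) auto
  also have "\<dots> \<le> (0.715 * r)\<^sup>2"
    using power_mono[OF r(1), of 2] by (simp add: power2_eq_square)
  finally have 4: "sqrt (sqrt (m + k)) \<le> 0.715 * r" by (rule real_le_lsqrt[rotated]) (use r in simp)
  have 5: "sqrt (2 * k) \<le> 1.415 * r"
    using r by (intro real_le_lsqrt) (auto simp: power_mult_distrib power_divide)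
  define L where "L = k * ln (real (m + 1) / k)"
  have "L + k - ln k - 1 \<le>
    2.212 * k + 3 * sqrt (2 * k) + 2.212 * sqrt (m + k) + 6 * sqrt (sqrt (m + k))"
    unfolding L_def using smooth_window_ineq[OF assms(1)] assms(2) by simp
  hence "4.36 * r\<^sup>2 \<le> 3.318 * r\<^sup>2 + 8.735 * r + 5.822"
    using 1 2 3 4 5 unfolding L_def[symmetric] r(2) by simp
  moreover have "10 * r \<le> r\<^sup>2" unfolding power2_eq_square using r by (intro mult_right_mono) auto
  ultimately show False using r by simp
qed

text \<open>Once \<open>m + k \<le> 30 * k\<close>, \<open>sqrt (m + k)\<close> is only of order
  \<open>sqrt k\<close>, and the slope in \<open>k\<close> drops to
  \<open>2.212 - 1 = 1.212\<close>.\<close>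

lemma smooth_window_ln_le:
  assumes "smooth_window m k" "200 \<le> k" "m + k \<le> 30 * k"
  shows "k * ln (real (m + 1) / k) \<le> 1.212 * k + 20.2 * sqrt k + 6.2"
proof -
  define r where "r = sqrt k"
  have r: "14 \<le> r" "r\<^sup>2 = k" using assms by (auto simp: r_def intro!: real_le_rsqrt)
  have "ln (r / 36) \<le> r / 36 - 1" using r by (intro ln_le_minus_one) auto
  moreover have "ln (36::real) = 2 * (ln 2 + ln 3)" using ln_mult[of 4 9] ln_realpow[of 2 2] ln_realpow[of 3 2] by simp
  moreover have "ln k = 2 * ln r" using r(1) r(2)[symmetric] by (simp add: ln_realpow)
  ultimately have 2: "ln k \<le> r / 18 + 5.17"
    using ln_2_approx ln_3_approx r by (simp add: ln_div)
  have "real (m + k) \<le> 30 * r\<^sup>2" using assms(3) r(2) by simp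
  hence 3: "sqrt (m + k) \<le> 5.48 * r" 
    using r by (intro real_le_lsqrt) (auto simp: power_mult_distrib power_divide)
  have "14 * r \<le> r\<^sup>2" unfolding power2_eq_square using r by (intro mult_right_mono) auto
  hence "5.48 * r \<le> (0.626 * r)\<^sup>2" using r by (simp add: power_mult_distrib power_divide)
  with 3 have "sqrt (m + k) \<le> (0.626 * r)\<^sup>2" by (rule order.trans)
  hence 4: "sqrt (sqrt (m + k)) \<le> 0.626 * r" by (rule real_le_lsqrt[rotated]) (use r in simp)
  have 5: "sqrt (2 * k) \<le> 1.415 * r"
    using r by (intro real_le_lsqrt) (auto simp: power_mult_distrib power_divide)
  show ?thesis
    using smooth_window_ineq[OF assms(1)] assms(2) 2 3 4 5 r unfolding r_def[symmetric] by simp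
qed

text \<open>From \<open>c * k \<le> m\<close> follows
  \<open>(ln c - 1.212) * r\<^sup>2 \<le> 20.2 * r + 6.2\<close> for \<open>r = sqrt k\<close>. As
  \<open>(20.2 * t + 6.2) / t\<^sup>2\<close> decreases in \<open>t\<close>, it suffices to refute
  this at one \<open>s \<le> r\<close>.\<close>

lemma smooth_window_contradiction:
  fixes m k c :: nat and s :: real
  assumes "smooth_window m k" "200 \<le> k" "m + k \<le> 30 * k" "c * k \<le> m" "0 < c"
    "s\<^sup>2 \<le> k" "0 < s" "20.2 * s + 6.2 < (ln c - 1.212) * s\<^sup>2"
  shows False
proof -
  define r where "r = sqrt k"
  have r: "s \<le> r" "r\<^sup>2 = k" using assms by (auto simp: r_def intro!: real_le_rsqrt)
  have "real c \<le> real (m + 1) / k"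
    using assms(2,4) by (simp add: field_simps flip: of_nat_mult)
  hence "ln c \<le> ln (real (m + 1) / k)" using assms(5) by (intro ln_mono) auto
  hence "ln c * k \<le> ln (real (m + 1) / k) * k" by (rule mult_right_mono) simp
  hence "ln c * r\<^sup>2 \<le> k * ln (real (m + 1) / k)" unfolding r(2) by (simp only: mult.commute)
  also have "\<dots> \<le> 1.212 * r\<^sup>2 + 20.2 * r + 6.2"
    using smooth_window_ln_le[OF assms(1-3)] r(2) by (simp add: r_def)
  finally have *: "(ln c - 1.212) * r\<^sup>2 \<le> 20.2 * r + 6.2" by (simp add: algebra_simps)
  have "(20.2 * s + 6.2) * r\<^sup>2 < (ln c - 1.212) * s\<^sup>2 * r\<^sup>2"
    using assms(2,8) r(2) by (intro mult_strict_right_mono) auto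
  also have "\<dots> \<le> (20.2 * r + 6.2) * s\<^sup>2"
    using mult_right_mono[OF *, of "s\<^sup>2"] by (simp add: mult_ac)
  also have "\<dots> \<le> (20.2 * s + 6.2) * r\<^sup>2"
  proof -
    have "r * s * s \<le> r * s * r" "s * s \<le> r * r" using r assms(7) by (auto intro!: mult_left_mono mult_mono)
    thus ?thesis by (simp add: power2_eq_square algebra_simps)
  qed
  finally show False by simp
qed

section \<open>Small parameters\<close>

text \<open>Every prime in the new range survives trial division by \<open>qs\<close>; composite
  survivors would only weaken the bound.\<close>

lemma prime_count_le_add_sieve:
  assumes "prime_count a \<le> c" "1 \<notin> set qs"
    "c + length (filter (\<lambda>r. list_all (\<lambda>q. r mod q \<noteq> 0 \<or> r = q) qs) [Suc a..<Suc b]) \<le> d"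
  shows "prime_count b \<le> d"
proof -
  let ?xs = "filter (\<lambda>r. list_all (\<lambda>q. r mod q \<noteq> 0 \<or> r = q) qs) [Suc a..<Suc b]"
  have "p \<in> set ?xs" if "prime p" "p \<le> b" "\<not> p \<le> a" for p
  proof -
    have "p mod q \<noteq> 0 \<or> p = q" if "q \<in> set qs" for q
    proof (rule disjCI)
      assume "p \<noteq> q"
      hence "\<not> q dvd p" using assms that \<open>prime p\<close> by (auto simp: prime_nat_iff)
      thus "p mod q \<noteq> 0" by (simp add: mod_eq_0_iff_dvd)
    qed
    moreover have "p \<in> {Suc a..<Suc b}" using that by auto
    ultimately show ?thesis unfolding set_filter set_upt list_all_iff by blast
  qed
  hence "{p. prime p \<and> p \<le> b} \<subseteq> {p. prime p \<and> p \<le> a} \<union> set ?xs" by blast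
  hence "prime_count b \<le> card ({p. prime p \<and> p \<le> a} \<union> set ?xs)"
    unfolding prime_count_def by (rule card_mono[rotated]) simp
  also have "\<dots> \<le> prime_count a + card (set ?xs)"
    unfolding prime_count_def by (rule card_Un_le)
  finally show ?thesis using card_length[of ?xs] assms(1,3) by linarith
qed

text \<open>The arguments up to 184 are \<open>2 * k\<close> for \<open>k = 2, 3, 4\<close> and for
  the left ends of the intervals of \<open>k\<close> treated below; the last four serve
  \<open>four_prime_count_le\<close>. Each sieve list holds the primes up to the square root of the
  argument.\<close>

lemma prime_count_table:
  "prime_count 4 \<le> 2" "prime_count 6 \<le> 3" "prime_count 8 \<le> 4" "prime_count 10 \<le> 4"
  "prime_count 14 \<le> 6" "prime_count 16 \<le> 6" "prime_count 22 \<le> 8" "prime_count 26 \<le> 9"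
  "prime_count 28 \<le> 9" "prime_count 36 \<le> 11" "prime_count 44 \<le> 14" "prime_count 48 \<le> 15"
  "prime_count 52 \<le> 15" "prime_count 60 \<le> 17" "prime_count 66 \<le> 18" "prime_count 70 \<le> 19"
  "prime_count 86 \<le> 23" "prime_count 100 \<le> 25" "prime_count 118 \<le> 30" "prime_count 132 \<le> 32"
  "prime_count 148 \<le> 34" "prime_count 168 \<le> 39" "prime_count 184 \<le> 42" "prime_count 232 \<le> 50"
  "prime_count 276 \<le> 58" "prime_count 348 \<le> 69" "prime_count 456 \<le> 87"
proof -
  have "{p::nat. prime p \<and> p \<le> 2} \<subseteq> {2}" by (auto dest: prime_ge_2_nat)
  from card_mono[OF _ this] have 0: "prime_count 2 \<le> 1" by (simp add: prime_count_def)
  show 1: "prime_count 4 \<le> 2"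
    by (rule prime_count_le_add_sieve[OF 0, of "[2]"]) (simp_all add: upt_rec_numeral)
  show 2: "prime_count 6 \<le> 3"
    by (rule prime_count_le_add_sieve[OF 1, of "[2]"]) (simp_all add: upt_rec_numeral)
  show 3: "prime_count 8 \<le> 4"
    by (rule prime_count_le_add_sieve[OF 2, of "[2]"]) (simp_all add: upt_rec_numeral)
  show 4: "prime_count 10 \<le> 4"
    by (rule prime_count_le_add_sieve[OF 3, of "[2, 3]"]) (simp_all add: upt_rec_numeral)
  show 5: "prime_count 14 \<le> 6"
    by (rule prime_count_le_add_sieve[OF 4, of "[2, 3]"]) (simp_all add: upt_rec_numeral)
  show 6: "prime_count 16 \<le> 6"
    by (rule prime_count_le_add_sieve[OF 5, of "[2, 3]"]) (simp_all add: upt_rec_numeral)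
  show 7: "prime_count 22 \<le> 8"
    by (rule prime_count_le_add_sieve[OF 6, of "[2, 3]"]) (simp_all add: upt_rec_numeral)
  show 8: "prime_count 26 \<le> 9"
    by (rule prime_count_le_add_sieve[OF 7, of "[2, 3, 5]"]) (simp_all add: upt_rec_numeral)
  show 9: "prime_count 28 \<le> 9"
    by (rule prime_count_le_add_sieve[OF 8, of "[2, 3, 5]"]) (simp_all add: upt_rec_numeral)
  show 10: "prime_count 36 \<le> 11"
    by (rule prime_count_le_add_sieve[OF 9, of "[2, 3, 5]"]) (simp_all add: upt_rec_numeral)
  show 11: "prime_count 44 \<le> 14"
    by (rule prime_count_le_add_sieve[OF 10, of "[2, 3, 5]"]) (simp_all add: upt_rec_numeral)
  show 12: "prime_count 48 \<le> 15"
    by (rule prime_count_le_add_sieve[OF 11, of "[2, 3, 5]"]) (simp_all add: upt_rec_numeral)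
  show 13: "prime_count 52 \<le> 15"
    by (rule prime_count_le_add_sieve[OF 12, of "[2, 3, 5, 7]"]) (simp_all add: upt_rec_numeral)
  show 14: "prime_count 60 \<le> 17"
    by (rule prime_count_le_add_sieve[OF 13, of "[2, 3, 5, 7]"]) (simp_all add: upt_rec_numeral)
  show 15: "prime_count 66 \<le> 18"
    by (rule prime_count_le_add_sieve[OF 14, of "[2, 3, 5, 7]"]) (simp_all add: upt_rec_numeral)
  show 16: "prime_count 70 \<le> 19"
    by (rule prime_count_le_add_sieve[OF 15, of "[2, 3, 5, 7]"]) (simp_all add: upt_rec_numeral)
  show 17: "prime_count 86 \<le> 23"
    by (rule prime_count_le_add_sieve[OF 16, of "[2, 3, 5, 7]"]) (simp_all add: upt_rec_numeral)
  show 18: "prime_count 100 \<le> 25"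
    by (rule prime_count_le_add_sieve[OF 17, of "[2, 3, 5, 7]"]) (simp_all add: upt_rec_numeral)
  show 19: "prime_count 118 \<le> 30"
    by (rule prime_count_le_add_sieve[OF 18, of "[2, 3, 5, 7]"]) (simp_all add: upt_rec_numeral)
  show 20: "prime_count 132 \<le> 32"
    by (rule prime_count_le_add_sieve[OF 19, of "[2, 3, 5, 7, 11]"]) (simp_all add: upt_rec_numeral)
  show 21: "prime_count 148 \<le> 34"
    by (rule prime_count_le_add_sieve[OF 20, of "[2, 3, 5, 7, 11]"]) (simp_all add: upt_rec_numeral)
  show 22: "prime_count 168 \<le> 39"
    by (rule prime_count_le_add_sieve[OF 21, of "[2, 3, 5, 7, 11]"]) (simp_all add: upt_rec_numeral)
  show 23: "prime_count 184 \<le> 42"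
    by (rule prime_count_le_add_sieve[OF 22, of "[2, 3, 5, 7, 11, 13]"]) (simp_all add: upt_rec_numeral)
  show 24: "prime_count 232 \<le> 50"
    by (rule prime_count_le_add_sieve[OF 23, of "[2, 3, 5, 7, 11, 13]"]) (simp_all add: upt_rec_numeral)
  show 25: "prime_count 276 \<le> 58"
    by (rule prime_count_le_add_sieve[OF 24, of "[2, 3, 5, 7, 11, 13]"]) (simp_all add: upt_rec_numeral)
  show 26: "prime_count 348 \<le> 69"
    by (rule prime_count_le_add_sieve[OF 25, of "[2, 3, 5, 7, 11, 13, 17]"]) (simp_all add: upt_rec_numeral)
  show 27: "prime_count 456 \<le> 87"
    by (rule prime_count_le_add_sieve[OF 26, of "[2, 3, 5, 7, 11, 13, 17, 19]"]) (simp_all add: upt_rec_numeral)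
qed

section \<open>Explicit bounds for \<open>5 \<le> k \<le> 99\<close>\<close>

lemma smooth_window_less_121:
  "smooth_window m k \<Longrightarrow> 5 \<le> k \<Longrightarrow> k \<le> 6 \<Longrightarrow> m + 1 < 121"
  by (rule smooth_window_less[of m k 5 6 4]) (simp_all add: prime_count_table fact_numeral)

text \<open>The bound is dictated by \<open>k = 7\<close>, with exponent \<open>7 - 6 = 1\<close>
  and factorial \<open>720\<close>.\<close>

lemma smooth_window_less_721:
  assumes "smooth_window m k" "7 \<le> k" "k \<le> 13"
  shows "m + 1 < 721"
proof -
  consider "7 \<le> k" "k \<le> 7" | "8 \<le> k" "k \<le> 10" | "11 \<le> k" "k \<le> 12" | "13 \<le> k" "k \<le> 13"
    using assms by linarith
  thus ?thesis
  proof cases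
    case 1
    show ?thesis
      by (rule smooth_window_less[OF assms(1) 1, of 6]) (simp_all add: prime_count_table fact_numeral)
  next
    case 2
    show ?thesis
      by (rule smooth_window_less[OF assms(1) 2, of 6]) (simp_all add: prime_count_table fact_numeral)
  next
    case 3
    show ?thesis
      by (rule smooth_window_less[OF assms(1) 3, of 8]) (simp_all add: prime_count_table fact_numeral)
  next
    case 4
    show ?thesis
      by (rule smooth_window_less[OF assms(1) 4, of 9]) (simp_all add: prime_count_table fact_numeral)
  qed
qed

lemma smooth_window_less_480:
  assumes "smooth_window m k" "14 \<le> k" "k \<le> 34"
  shows "m + 1 < 480"
proof -
  consider "14 \<le> k" "k \<le> 17" | "18 \<le> k" "k \<le> 21" | "22 \<le> k" "k \<le> 23" | "24 \<le> k" "k \<le> 25" | "26 \<le> k" "k \<le> 29" | "30 \<le> k" "k \<le> 32" | "33 \<le> k" "k \<le> 34"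
    using assms by linarith
  thus ?thesis
  proof cases
    case 1
    show ?thesis
      by (rule smooth_window_less[OF assms(1) 1, of 9]) (simp_all add: prime_count_table fact_numeral)
  next
    case 2
    show ?thesis
      by (rule smooth_window_less[OF assms(1) 2, of 11]) (simp_all add: prime_count_table fact_numeral)
  next
    case 3
    show ?thesis
      by (rule smooth_window_less[OF assms(1) 3, of 14]) (simp_all add: prime_count_table fact_numeral)
  next
    case 4
    show ?thesis
      by (rule smooth_window_less[OF assms(1) 4, of 15]) (simp_all add: prime_count_table fact_numeral)
  next
    case 5
    show ?thesis
      by (rule smooth_window_less[OF assms(1) 5, of 15]) (simp_all add: prime_count_table fact_numeral)
  next
    case 6
    show ?thesis
      by (rule smooth_window_less[OF assms(1) 6, of 17]) (simp_all add: prime_count_table fact_numeral)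
  next
    case 7
    show ?thesis
      by (rule smooth_window_less[OF assms(1) 7, of 18]) (simp_all add: prime_count_table fact_numeral)
  qed
qed

lemma smooth_window_less_1250:
  assumes "smooth_window m k" "35 \<le> k" "k \<le> 99"
  shows "m + 1 < 1250"
proof -
  consider "35 \<le> k" "k \<le> 42" | "43 \<le> k" "k \<le> 49" | "50 \<le> k" "k \<le> 58" | "59 \<le> k" "k \<le> 65" | "66 \<le> k" "k \<le> 73" | "74 \<le> k" "k \<le> 83" | "84 \<le> k" "k \<le> 91" | "92 \<le> k" "k \<le> 99"
    using assms by linarith
  thus ?thesis
  proof cases
    case 1
    show ?thesis
      by (rule smooth_window_less[OF assms(1) 1, of 19]) (simp_all add: prime_count_table fact_numeral)
  next
    case 2
    show ?thesis
      by (rule smooth_window_less[OF assms(1) 2, of 23]) (simp_all add: prime_count_table fact_numeral)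
  next
    case 3
    show ?thesis
      by (rule smooth_window_less[OF assms(1) 3, of 25]) (simp_all add: prime_count_table fact_numeral)
  next
    case 4
    show ?thesis
      by (rule smooth_window_less[OF assms(1) 4, of 30]) (simp_all add: prime_count_table fact_numeral)
  next
    case 5
    show ?thesis
      by (rule smooth_window_less[OF assms(1) 5, of 32]) (simp_all add: prime_count_table fact_numeral)
  next
    case 6
    show ?thesis
      by (rule smooth_window_less[OF assms(1) 6, of 34]) (simp_all add: prime_count_table fact_numeral)
  next
    case 7
    show ?thesis
      by (rule smooth_window_less[OF assms(1) 7, of 39]) (simp_all add: prime_count_table fact_numeral)
  next
    case 8
    show ?thesis
      by (rule smooth_window_less[OF assms(1) 8, of 42]) (simp_all add: prime_count_table fact_numeral)
  qed
qed

section \<open>Powers of 2 and 3, and windows of length at most 4\<close>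

lemma power_three_mod_80: "(3::nat) ^ y mod 80 \<in> {1, 3, 9, 27}"
proof (induction y)
  case (Suc y)
  have "3 ^ Suc y mod 80 = 3 * (3 ^ y mod 80) mod (80::nat)" by (simp add: mod_mult_right_eq)
  thus ?case using Suc by auto
qed auto

text \<open>For \<open>x \<ge> 4\<close>, 16 divides \<open>2 ^ x\<close>. The residues 1, 3, 9, 27
  of \<open>3 ^ y\<close> modulo 80 leave only \<open>2 ^ x = 3 ^ y - 1\<close> with residue 1, and
  then 5 would divide \<open>2 ^ x\<close>.\<close>

lemma consecutive_powers_two_three:
  assumes "(2::nat) ^ x = 3 ^ y + 1 \<or> 3 ^ y = (2::nat) ^ x + 1"
  shows "x \<le> 3"
proof (rule ccontr)
  assume "\<not> x \<le> 3"
  hence dvd16: "(16::nat) dvd 2 ^ x" using le_imp_power_dvd[of 4 x "2::nat"] by simp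
  define t where "t = (3::nat) ^ y mod 80"
  have t: "t \<in> {1, 3, 9, 27}" unfolding t_def by (rule power_three_mod_80)
  have decomp: "3 ^ y = 80 * (3 ^ y div 80) + t" by (simp add: t_def)
  have dvd80: "16 dvd 80 * z + w \<longleftrightarrow> 16 dvd w" for z w :: nat
    by (rule dvd_add_right_iff) simp
  from assms show False
  proof
    assume "(2::nat) ^ x = 3 ^ y + 1"
    hence "(16::nat) dvd 80 * (3 ^ y div 80) + (t + 1)" using dvd16 decomp by simp
    hence "16 dvd t + 1" by (simp only: dvd80)
    thus False using t by (auto simp flip: numeral_2_eq_2)
  next
    assume *: "(3::nat) ^ y = 2 ^ x + 1"
    have "t = 1"
    proof (rule ccontr)
      assume "t \<noteq> 1"
      have "1 \<le> t" using t by auto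
      hence "(2::nat) ^ x = 80 * (3 ^ y div 80) + (t - 1)" using * decomp by linarith
      hence "16 dvd t - 1" using dvd16 by (simp only: dvd80)
      thus False using t \<open>t \<noteq> 1\<close> by auto
    qed
    hence "(2::nat) ^ x = 5 * (16 * (3 ^ y div 80))" using * decomp by linarith
    hence "(5::nat) dvd 2 ^ x" by simp
    hence "(5::nat) dvd 2" by (rule prime_dvd_power_nat[rotated]) simp
    thus False by simp
  qed
qed

text \<open>As \<open>d \<le> 3\<close>, the cofactors \<open>3 ^ u\<close> and \<open>2 ^ v\<close>
  are trivial, except for \<open>u = 1\<close> with \<open>d = 3\<close> or \<open>v = 1\<close>
  with \<open>d = 2\<close>. Cancelling the common factor leaves a power of 2 and a power of 3 that
  differ by 1.\<close>

lemma close_powers_two_three: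
  fixes a b :: nat
  assumes a: "a = 2 ^ x * 3 ^ u" and b: "b = 2 ^ v * 3 ^ y"
    and "a = b + d \<or> b = a + d" "0 < d" "d \<le> 3" "8 \<le> a" "8 \<le> b"
    and "3 ^ u dvd d" "2 ^ v dvd d"
  shows "a \<le> 24"
proof -
  have u: "u = 0 \<or> u = 1 \<and> d = 3"
  proof (cases "u = 0")
    case False
    hence "(3::nat) dvd 3 ^ u" by simp
    hence "3 dvd d" using assms(8) by (rule dvd_trans)
    hence "d = 3" using assms(4,5) dvd_imp_le[of 3 d] by simp
    moreover have "u < 2"
    proof (rule ccontr)
      assume "\<not> u < 2"
      hence "(3::nat) ^ 2 dvd 3 ^ u" by (intro le_imp_power_dvd) simp
      hence "3 ^ 2 dvd d" using assms(8) by (rule dvd_trans)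
      thus False using \<open>d = 3\<close> by simp
    qed
    ultimately show ?thesis using False by simp
  qed simp
  have v: "v = 0 \<or> v = 1 \<and> d = 2"
  proof (cases "v = 0")
    case False
    hence "(2::nat) dvd 2 ^ v" by simp
    hence "2 dvd d" using assms(9) by (rule dvd_trans)
    hence "d = 2" using assms(4,5) by presburger
    moreover have "v < 2"
    proof (rule ccontr)
      assume "\<not> v < 2"
      hence "(2::nat) ^ 2 dvd 2 ^ v" by (intro le_imp_power_dvd) simp
      hence "2 ^ 2 dvd d" using assms(9) by (rule dvd_trans)
      thus False using \<open>d = 2\<close> by simp
    qed
    ultimately show ?thesis using False by simp
  qed simp
  have odd3: "odd ((3::nat) ^ z)" for z by simp
  have le8: "(2::nat) ^ z \<le> 8" if "(2::nat) ^ z = 3 ^ w + 1 \<or> 3 ^ w = (2::nat) ^ z + 1" for z w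
    using power_increasing[OF consecutive_powers_two_three[OF that], of "2::nat"] by simp
  consider "u = 0" "v = 0" | "u = 1" "v = 0" "d = 3" | "u = 0" "v = 1" "d = 2"
    using u v by auto
  thus ?thesis
  proof cases
    case 1
    have "x \<noteq> 0" "y \<noteq> 0" using 1 a b assms(6,7) by (auto intro!: Nat.gr0I)
    hence "even a" "odd b" "3 dvd b" using 1 a b by auto
    have "\<not> 3 dvd a"
    proof
      assume "3 dvd a"
      hence "(3::nat) dvd 2" using 1 a by (intro prime_dvd_power_nat[of 3 2 x]) auto
      thus False by simp
    qed
    have "d \<noteq> 2" using \<open>even a\<close> \<open>odd b\<close> assms(3) by auto
    moreover have "d \<noteq> 3" using \<open>\<not> 3 dvd a\<close> \<open>3 dvd b\<close> assms(3) by presburger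
    ultimately have "d = 1" using assms(4,5) by simp
    hence "a \<le> 8" using le8[of x y] 1 a b assms(3) by auto
    thus ?thesis by simp
  next
    case 2
    then obtain y' where "y = Suc y'" using b assms(7) by (cases y) auto
    hence "2 ^ x \<le> (8::nat)" using le8[of x y'] 2 a b assms(3) by auto
    thus ?thesis using 2 a by simp
  next
    case 3
    then obtain x' where "x = Suc x'" using a assms(6) by (cases x) auto
    hence "2 ^ x' \<le> (8::nat)" using le8[of x' y] 3 a b assms(3) by auto
    thus ?thesis using 3 a \<open>x = Suc x'\<close> by simp
  qed
qed

lemma eq_power_two_three:
  fixes x :: nat
  assumes "x \<noteq> 0" "\<And>q. prime q \<Longrightarrow> q dvd x \<Longrightarrow> q = 2 \<or> q = 3"
  shows "x = 2 ^ multiplicity 2 x * 3 ^ multiplicity 3 x"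
proof -
  have "x = (\<Prod>p\<in>prime_factors x. p ^ multiplicity p x)"
    using assms(1) by (simp add: prime_factorization_nat)
  also have "\<dots> = (\<Prod>p\<in>{2, 3}. p ^ multiplicity p x)"
  proof (rule prod.mono_neutral_left)
    show "prime_factors x \<subseteq> {2, 3}" using assms(2) by (auto simp: in_prime_factors_iff)
    show "\<forall>p\<in>{2, 3} - prime_factors x. p ^ multiplicity p x = 1"
      using assms(1) by (auto simp: in_prime_factors_iff not_dvd_imp_multiplicity_0)
  qed simp
  finally show ?thesis by simp
qed

text \<open>For \<open>m \<ge> 7\<close> no number of the window divides
  \<open>fact (k - 1) \<le> 6\<close>, so all are owners, and by counting, distinct primes have
  distinct owners. A prime \<open>q \<ge> 5\<close> dividing \<open>own 2\<close> or
  \<open>own 3\<close> would divide its distance to \<open>own q\<close>, which is at most 3. Thus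
  \<open>own 2\<close> and \<open>own 3\<close> are close products of powers of 2 and 3.\<close>

lemma smooth_window_small:
  assumes smooth: "smooth_window m k" and k: "2 \<le> k" "k \<le> 4" and pc: "prime_count (2 * k) \<le> k"
  shows "m + k \<le> 27"
proof (cases "7 \<le> m")
  case m: True
  let ?S = "{m<..m+k}" and ?P = "{p::nat. prime p \<and> p \<le> 2 * k}"
  have "0 < k" using k by simp
  obtain own where own': "\<forall>p. own p \<in> ?S \<and> (\<forall>x\<in>?S. multiplicity p x \<le> multiplicity p (own p))"
    "\<Prod>(?S - own ` ?P) dvd fact (k - 1)"
    using smooth_window_owners[OF smooth \<open>0 < k\<close>] by blast
  have own: "own p \<in> ?S" "x \<in> ?S \<Longrightarrow> multiplicity p x \<le> multiplicity p (own p)" for p x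
    using own'(1) by blast+
  have "?S \<subseteq> own ` ?P"
  proof
    fix x assume x: "x \<in> ?S"
    show "x \<in> own ` ?P"
    proof (rule ccontr)
      assume "x \<notin> own ` ?P"
      hence "x dvd \<Prod>(?S - own ` ?P)" using x by (intro dvd_prodI) auto
      hence "x dvd fact (k - 1)" using own'(2) by (rule dvd_trans)
      hence "x \<le> fact (k - 1)" by (rule dvd_imp_le) simp
      also have "fact (k - 1) \<le> (fact 3 :: nat)" using k by (intro fact_mono_nat) auto
      finally show False using x m by (simp add: fact_numeral)
    qed
  qed
  hence "card ?S \<le> card (own ` ?P)" by (intro card_mono) auto
  hence "card (own ` ?P) = card ?P"
    using pc card_image_le[of ?P own] by (simp add: prime_count_def)
  hence inj: "inj_on own ?P" by (intro eq_card_imp_inj_on) auto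
  have dist: "\<exists>d. (x = own p + d \<or> own p = x + d) \<and> 0 < d \<and> d \<le> 3 \<and> p ^ multiplicity p x dvd d"
    if x: "x \<in> ?S" "x \<noteq> own p" for p x
  proof (cases "x < own p")
    case True
    thus ?thesis using x own(1)[of p] k power_multiplicity_dvd_diff(1)[OF own(2)[OF x(1), of p]]
      by (intro exI[of _ "own p - x"]) auto
  next
    case False
    thus ?thesis using x own(1)[of p] k power_multiplicity_dvd_diff(2)[OF own(2)[OF x(1), of p]]
      by (intro exI[of _ "x - own p"]) auto
  qed
  have prime_dvd_own: "q = 2 \<or> q = 3" if q: "prime q" "q dvd own p" and p: "p = 2 \<or> p = 3" for p q
  proof (rule ccontr)
    assume ne: "\<not> (q = 2 \<or> q = 3)"
    have "q \<in> ?P" using smooth q own(1)[of p] by (auto simp: smooth_window_def)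
    moreover have "p \<in> ?P" using p k by auto
    ultimately have "own p \<noteq> own q" using inj ne p by (auto dest: inj_onD)
    then obtain d where d: "0 < d" "d \<le> 3" "q ^ multiplicity q (own p) dvd d"
      using dist[of "own p" q] own(1) by blast
    have "multiplicity q (own p) > 0"
      using q own(1)[of p] by (intro prime_multiplicity_gt_zero_iff[THEN iffD2]) auto
    hence "q dvd q ^ multiplicity q (own p)" by simp
    hence "q dvd d" using d(3) by (rule dvd_trans)
    hence "q \<le> 3" using d dvd_imp_le[of q d] by simp
    thus False using ne prime_ge_2_nat[OF q(1)] by simp
  qed
  have ne: "own 2 \<noteq> own 3" using inj k by (auto dest!: inj_onD[of own ?P 2 3])
  obtain d where d: "own 2 = own 3 + d \<or> own 3 = own 2 + d" "0 < d" "d \<le> 3"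
    "3 ^ multiplicity 3 (own 2) dvd d"
    using dist[of "own 2" 3] own(1) ne by blast
  obtain d' where d': "own 3 = own 2 + d' \<or> own 2 = own 3 + d'" "0 < d'" "2 ^ multiplicity 2 (own 3) dvd d'"
    using dist[of "own 3" 2] own(1) ne by metis
  have "d' = d" using d d' by linarith
  have "own 2 \<le> 24"
  proof (rule close_powers_two_three)
    show "own 2 = 2 ^ multiplicity 2 (own 2) * 3 ^ multiplicity 3 (own 2)"
      using own(1)[of 2] prime_dvd_own by (intro eq_power_two_three) auto
    show "own 3 = 2 ^ multiplicity 2 (own 3) * 3 ^ multiplicity 3 (own 3)"
      using own(1)[of 3] prime_dvd_own by (intro eq_power_two_three) auto
    show "8 \<le> own 2" "8 \<le> own 3" using own(1)[of 2] own(1)[of 3] m by auto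
  qed (use d d' \<open>d' = d\<close> in simp_all)
  thus ?thesis using own(1)[of 2] k by simp
qed (use k in simp)

section \<open>Explicit primes\<close>

primrec chain :: "('a \<Rightarrow> 'a \<Rightarrow> bool) \<Rightarrow> 'a \<Rightarrow> 'a list \<Rightarrow> bool" where
  "chain R x [] = True"
| "chain R x (y # ys) = (R x y \<and> chain R y ys)"

lemma chain_bracket:
  fixes n :: "'a :: linorder"
  assumes "chain R x ys" "x \<le> n" "n < last (x # ys)"
  shows "\<exists>a\<in>set (x # ys). \<exists>b. R a b \<and> a \<le> n \<and> n < b"
  using assms
proof (induction ys arbitrary: x)
  case (Cons y ys)
  show ?case
  proof (cases "n < y")
    case True
    thus ?thesis using Cons.prems by auto
  next
    case False
    hence "\<exists>a\<in>set (y # ys). \<exists>b. R a b \<and> a \<le> n \<and> n < b"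
      using Cons.prems by (intro Cons.IH) auto
    thus ?thesis by auto
  qed
qed auto

text \<open>Contains every prime below \<open>6 * k + 5\<close>, since primes above 3 are 1 or 5
  modulo 6.\<close>

definition wheel_divisors :: "nat \<Rightarrow> nat list" where
  "wheel_divisors k = 2 # 3 # concat (map (\<lambda>i. [6 * i + 5, 6 * i + 7]) [0..<k])"

primrec no_proper_divisor_in :: "nat list \<Rightarrow> nat \<Rightarrow> bool" where
  "no_proper_divisor_in [] n = True"
| "no_proper_divisor_in (q # qs) n = ((n mod q \<noteq> 0 \<or> n = q) \<and> no_proper_divisor_in qs n)"

definition wheel_prime :: "nat \<Rightarrow> nat \<Rightarrow> bool" where
  "wheel_prime k n \<longleftrightarrow> 1 < n \<and> n < (6 * k + 5)\<^sup>2 \<and> no_proper_divisor_in (wheel_divisors k) n"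

lemma no_proper_divisor_in_iff: "no_proper_divisor_in qs n \<longleftrightarrow> (\<forall>q\<in>set qs. n mod q \<noteq> 0 \<or> n = q)"
  by (induction qs) auto

lemma prime_if_wheel_prime:
  assumes "wheel_prime k n"
  shows "prime n"
proof (rule ccontr)
  assume "\<not> prime n"
  have n1: "1 < n" and lt: "n < (6 * k + 5)\<^sup>2"
    and ndvd: "\<And>q. q \<in> set (wheel_divisors k) \<Longrightarrow> n mod q \<noteq> 0 \<or> n = q"
    using assms by (auto simp: wheel_prime_def no_proper_divisor_in_iff)
  from \<open>\<not> prime n\<close> n1 obtain q where q: "prime q" "q dvd n" "q\<^sup>2 \<le> n"
    by (auto simp: prime_prime_factor_sqrt[of n])
  have "q\<^sup>2 < (6 * k + 5)\<^sup>2" using q lt by linarith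
  hence "q < 6 * k + 5" using power_less_imp_less_base by blast
  have "q \<noteq> n"
    using q n1 self_le_power[of q 2] by (auto simp: power2_eq_square)
  have "q \<in> set (wheel_divisors k)"
  proof (cases "q = 2 \<or> q = 3")
    case False
    have "\<not> 2 dvd q" "\<not> 3 dvd q" using False q(1) primes_dvd_imp_eq[of 2 q] primes_dvd_imp_eq[of 3 q] by auto
    moreover have "q \<noteq> 1" using q(1) by auto
    ultimately have "\<exists>i. q = 6 * i + 5 \<or> q = 6 * i + 7" by presburger
    then obtain i where "q = 6 * i + 5 \<or> q = 6 * i + 7" ..
    moreover from this have "i < k" using \<open>q < 6 * k + 5\<close> by auto
    ultimately show ?thesis by (auto simp: wheel_divisors_def)
  qed (auto simp: wheel_divisors_def)
  thus False using ndvd[of q] \<open>q \<noteq> n\<close> q by (auto simp: mod_eq_0_iff_dvd)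
qed

lemma list_all_wheel_prime: "list_all (wheel_prime k) xs \<Longrightarrow> list_all prime xs"
  by (auto simp: list_all_iff prime_if_wheel_prime)

lemma wheel_divisors_6: "wheel_divisors 6 = [2, 3, 5, 7, 11, 13, 17, 19, 23, 25, 29, 31, 35, 37]"
  by (simp add: wheel_divisors_def upt_rec_numeral upt_conv_Cons[of 0] upt_conv_Cons[of "Suc 0"] numeral_2_eq_2[symmetric])

text \<open>In the five cover lists the steps are no longer than the shortest window considered, and
  the last product passes the bound on \<open>m + k\<close>: 27 for \<open>k \<le> 4\<close>, 125
  for \<open>k \<le> 6\<close>, 732 for \<open>k \<le> 13\<close>.\<close>

definition smooth_cover_2 :: "(nat \<times> nat) list" where
  "smooth_cover_2 = [
    (1,13), (3,5), (1,17), (1,19), (3,7), (1,23), (5,5), (2,13), (4,7)]"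

definition smooth_cover_3 :: "(nat \<times> nat) list" where
  "smooth_cover_3 = [
    (2,7), (1,17), (1,19), (2,11), (1,23), (2,13), (1,29)]"

definition smooth_cover_4 :: "(nat \<times> nat) list" where
  "smooth_cover_4 = [
    (1,13), (1,17), (1,19), (1,23), (2,13), (1,29)]"

definition smooth_cover_5_6 :: "(nat \<times> nat) list" where
  "smooth_cover_5_6 = [
    (1,13), (1,17), (1,19), (1,23), (2,13), (1,31), (2,17), (3,13), (1,43), (1,47), (4,13),
    (3,19), (2,31), (1,67), (1,71), (4,19), (1,79), (1,83), (3,29), (4,23), (1,97), (6,17),
    (1,107), (3,37), (4,29), (7,17), (4,31), (3,43)]"

definition smooth_cover_7_13 :: "(nat \<times> nat) list" where
  "smooth_cover_7_13 = [
    (1,17), (1,23), (1,29), (1,31), (1,37), (1,43), (1,47), (1,53), (1,59), (2,31), (1,67),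
    (2,37), (1,79), (2,43), (3,31), (1,97), (1,103), (1,109), (4,29), (3,41), (3,43), (2,67),
    (3,47), (4,37), (5,31), (3,53), (2,83), (1,173), (1,179), (6,31), (1,193), (1,199), (2,103),
    (3,71), (3,73), (2,113), (1,233), (1,239), (6,41), (1,251), (6,43), (5,53), (1,271), (2,139),
    (4,71), (3,97), (2,149), (5,61), (1,311), (6,53), (3,107), (8,41), (5,67), (11,31), (12,29),
    (5,71), (2,181), (9,41), (8,47), (1,383), (1,389), (5,79), (6,67), (1,409), (5,83), (2,211),
    (4,107), (15,29), (1,439), (2,223), (3,151), (2,229), (15,31), (8,59), (1,479), (5,97),
    (12,41), (1,499), (5,101), (7,73), (14,37), (4,131), (9,59), (2,269), (5,109), (19,29),
    (18,31), (5,113), (1,571), (1,577), (8,73), (3,197), (3,199), (4,151), (13,47), (6,103),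
    (7,89), (17,37), (12,53), (1,643), (11,59), (16,41), (2,331), (3,223), (2,337), (3,227),
    (16,43), (5,139), (1,701), (12,59), (23,31), (1,719), (25,29), (12,61), (1,739)]"

text \<open>The last prime lies beyond \<open>478 + 34\<close>, the largest possible
  \<open>m + k\<close>; that of the next list lies beyond \<open>1248 + 99\<close>.\<close>

definition prime_chain_14_34 :: "nat list" where
  "prime_chain_14_34 = [
    23, 37, 47, 61, 73, 83, 97, 109, 113, 127, 139, 151, 163, 173, 181, 193, 199, 211, 223,
    233, 241, 251, 263, 277, 283, 293, 307, 317, 331, 337, 349, 359, 373, 383, 397, 409, 421, 433,
    443, 457, 467, 479, 491, 503, 509, 523]"

definition prime_chain_35_99 :: "nat list" where
  "prime_chain_35_99 = [
    43, 73, 107, 139, 173, 199, 233, 263, 293, 317, 349, 383, 409, 443, 467, 499, 523, 557,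
    587, 619, 653, 683, 709, 743, 773, 797, 829, 863, 887, 919, 953, 983, 1013, 1039, 1069, 1103,
    1129, 1163, 1193, 1223, 1249, 1283, 1307, 1327, 1361]"

text \<open>First piece of a chain past 96000, cut to suit trial division: the three pieces stay
  below \<open>59^2\<close>, \<open>113^2\<close> and \<open>329^2\<close>.\<close>

definition prime_chain_100a :: "nat list" where
  "prime_chain_100a = [
    109, 199, 293, 389, 487, 587, 683, 773, 863, 953, 1051, 1151, 1249, 1327, 1427, 1523, 1621,
    1721, 1811, 1907, 2003, 2099, 2179, 2273, 2371, 2467, 2557, 2657, 2753, 2851, 2939, 3037, 3137,
    3229, 3331, 3433]"

definition prime_chain_100b :: "nat list" where
  "prime_chain_100b = [
    3547, 3659, 3779, 3907, 4027, 4159, 4297, 4441, 4591, 4733, 4889, 5051, 5209, 5387, 5569, 5749,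
    5939, 6143, 6737, 7393, 8123, 8933, 9817, 10789, 11867]"

definition prime_chain_100c :: "nat list" where
  "prime_chain_100c = [
    13049, 14347, 16729, 19507, 22751, 26539, 30949, 36107, 42101, 49117, 57301, 66851, 77983,
    90977, 106129]"

lemma wheel_divisors_9: "wheel_divisors 9 = [
    2, 3, 5, 7, 11, 13, 17, 19, 23, 25, 29, 31, 35, 37, 41, 43, 47, 49, 53, 55]"
  by (simp add: wheel_divisors_def upt_rec_numeral upt_conv_Cons[of 0] upt_conv_Cons[of "Suc 0"] numeral_2_eq_2[symmetric])

lemma wheel_divisors_18: "wheel_divisors 18 = [
    2, 3, 5, 7, 11, 13, 17, 19, 23, 25, 29, 31, 35, 37, 41, 43, 47, 49, 53, 55, 59, 61, 65, 67, 71,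
    73, 77, 79, 83, 85, 89, 91, 95, 97, 101, 103, 107, 109]"
  by (simp add: wheel_divisors_def upt_rec_numeral upt_conv_Cons[of 0] upt_conv_Cons[of "Suc 0"] numeral_2_eq_2[symmetric])

lemma wheel_divisors_54: "wheel_divisors 54 = [
    2, 3, 5, 7, 11, 13, 17, 19, 23, 25, 29, 31, 35, 37, 41, 43, 47, 49, 53, 55, 59, 61, 65, 67, 71,
    73, 77, 79, 83, 85, 89, 91, 95, 97, 101, 103, 107, 109, 113, 115, 119, 121, 125, 127, 131, 133,
    137, 139, 143, 145, 149, 151, 155, 157, 161, 163, 167, 169, 173, 175, 179, 181, 185, 187, 191,
    193, 197, 199, 203, 205, 209, 211, 215, 217, 221, 223, 227, 229, 233, 235, 239, 241, 245, 247,
    251, 253, 257, 259, 263, 265, 269, 271, 275, 277, 281, 283, 287, 289, 293, 295, 299, 301, 305,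
    307, 311, 313, 317, 319, 323, 325]"
  by (simp add: wheel_divisors_def upt_rec_numeral upt_conv_Cons[of 0] upt_conv_Cons[of "Suc 0"] numeral_2_eq_2[symmetric])

lemma prime_chain_14_34: "list_all prime prime_chain_14_34"
  "chain (\<lambda>a b. b \<le> a + 14) 11 prime_chain_14_34"
  unfolding prime_chain_14_34_def
  by (rule list_all_wheel_prime[of 6]; simp add: wheel_prime_def wheel_divisors_6) simp

lemma prime_chain_35_99: "list_all prime prime_chain_35_99"
  "chain (\<lambda>a b. b \<le> a + 35) 11 prime_chain_35_99"
  unfolding prime_chain_35_99_def
  by (rule list_all_wheel_prime[of 6]; simp add: wheel_prime_def wheel_divisors_6) simp

text \<open>The alternatives match the bounds \<open>n < c k\<close> for \<open>c = 30, 11, 7\<close> and \<open>k \<ge> 100\<close>.\<close>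
definition chain_step :: "nat \<Rightarrow> nat \<Rightarrow> bool" where
  "chain_step a b \<longleftrightarrow> b \<le> a + 100 \<or> 29 * b \<le> 30 * a \<or>
     6000 \<le> a \<and> 10 * b \<le> 11 * a \<or> 14000 \<le> a \<and> 6 * b \<le> 7 * a"

lemma prime_chain_100a: "list_all prime prime_chain_100a"
  unfolding prime_chain_100a_def
  by (rule list_all_wheel_prime[of 9]; simp add: wheel_prime_def wheel_divisors_9)

lemma prime_chain_100b: "list_all prime prime_chain_100b"
  unfolding prime_chain_100b_def
  by (rule list_all_wheel_prime[of 18]; simp add: wheel_prime_def wheel_divisors_18)

lemma prime_chain_100c: "list_all prime prime_chain_100c"
  unfolding prime_chain_100c_def
  by (rule list_all_wheel_prime[of 54]; simp add: wheel_prime_def wheel_divisors_54)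

lemma chain_100: "chain chain_step 11 (prime_chain_100a @ prime_chain_100b @ prime_chain_100c)"
  by (simp add: chain_step_def prime_chain_100a_def prime_chain_100b_def prime_chain_100c_def)

text \<open>
  An entry \<open>(c, p)\<close> stands for the number \<open>c * p\<close>, which no smooth window without primes may contain.
  The initial prime \<open>11\<close> is left out of all lists.
\<close>
definition smooth_cover :: "nat \<Rightarrow> nat \<Rightarrow> (nat \<times> nat) list \<Rightarrow> bool" where
  "smooth_cover g l xs \<longleftrightarrow> list_all prime (map snd xs) \<and>
     list_all (\<lambda>(c, p). c = 1 \<or> l < p) xs \<and> chain (\<lambda>a b. b \<le> a + g) 11 (map (\<lambda>(c, p). c * p) xs)"

lemma smooth_cover_2: "smooth_cover 2 4 smooth_cover_2"
proof -
  have "list_all prime (map snd smooth_cover_2)"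
    unfolding smooth_cover_2_def
    by (rule list_all_wheel_prime[of 6]; simp add: wheel_prime_def wheel_divisors_6)
  moreover have "list_all (\<lambda>(c, p). c = 1 \<or> 4 < p) smooth_cover_2"
    by (simp add: smooth_cover_2_def)
  moreover have "chain (\<lambda>a b. b \<le> a + 2) 11 (map (\<lambda>(c, p). c * p) smooth_cover_2)"
    by (simp add: smooth_cover_2_def)
  ultimately show ?thesis unfolding smooth_cover_def by (intro conjI)
qed

lemma smooth_cover_3: "smooth_cover 3 6 smooth_cover_3"
proof -
  have "list_all prime (map snd smooth_cover_3)"
    unfolding smooth_cover_3_def
    by (rule list_all_wheel_prime[of 6]; simp add: wheel_prime_def wheel_divisors_6)
  moreover have "list_all (\<lambda>(c, p). c = 1 \<or> 6 < p) smooth_cover_3"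
    by (simp add: smooth_cover_3_def)
  moreover have "chain (\<lambda>a b. b \<le> a + 3) 11 (map (\<lambda>(c, p). c * p) smooth_cover_3)"
    by (simp add: smooth_cover_3_def)
  ultimately show ?thesis unfolding smooth_cover_def by (intro conjI)
qed

lemma smooth_cover_4: "smooth_cover 4 8 smooth_cover_4"
proof -
  have "list_all prime (map snd smooth_cover_4)"
    unfolding smooth_cover_4_def
    by (rule list_all_wheel_prime[of 6]; simp add: wheel_prime_def wheel_divisors_6)
  moreover have "list_all (\<lambda>(c, p). c = 1 \<or> 8 < p) smooth_cover_4"
    by (simp add: smooth_cover_4_def)
  moreover have "chain (\<lambda>a b. b \<le> a + 4) 11 (map (\<lambda>(c, p). c * p) smooth_cover_4)"
    by (simp add: smooth_cover_4_def)
  ultimately show ?thesis unfolding smooth_cover_def by (intro conjI)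
qed

lemma smooth_cover_5_6: "smooth_cover 5 12 smooth_cover_5_6"
proof -
  have "list_all prime (map snd smooth_cover_5_6)"
    unfolding smooth_cover_5_6_def
    by (rule list_all_wheel_prime[of 6]; simp add: wheel_prime_def wheel_divisors_6)
  moreover have "list_all (\<lambda>(c, p). c = 1 \<or> 12 < p) smooth_cover_5_6"
    by (simp add: smooth_cover_5_6_def)
  moreover have "chain (\<lambda>a b. b \<le> a + 5) 11 (map (\<lambda>(c, p). c * p) smooth_cover_5_6)"
    by (simp add: smooth_cover_5_6_def)
  ultimately show ?thesis unfolding smooth_cover_def by (intro conjI)
qed

lemma smooth_cover_7_13: "smooth_cover 7 26 smooth_cover_7_13"
proof -
  have "list_all prime (map snd smooth_cover_7_13)"
    unfolding smooth_cover_7_13_def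
    by (rule list_all_wheel_prime[of 6]; simp add: wheel_prime_def wheel_divisors_6)
  moreover have "list_all (\<lambda>(c, p). c = 1 \<or> 26 < p) smooth_cover_7_13"
    by (simp add: smooth_cover_7_13_def)
  moreover have "chain (\<lambda>a b. b \<le> a + 7) 11 (map (\<lambda>(c, p). c * p) smooth_cover_7_13)"
    by (simp add: smooth_cover_7_13_def)
  ultimately show ?thesis unfolding smooth_cover_def by (intro conjI)
qed

section \<open>Every smooth window contains a prime\<close>

lemma prime_count_mono: "x \<le> y \<Longrightarrow> prime_count x \<le> prime_count y"
  unfolding prime_count_def by (intro card_mono) auto

text \<open>Induction in steps of 210, where the left side grows by at most
  \<open>4 * 48 = 192\<close>. The numbers from 200 to 409 are the start; on each interval the table
  value is at most a quarter of the left end.\<close>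

lemma four_prime_count_le: "200 \<le> x \<Longrightarrow> 4 * prime_count x \<le> x"
proof (induction x rule: less_induct)
  case (less x)
  show ?case
  proof (cases "x < 410")
    case True
    have *: "4 * prime_count x \<le> x" if "prime_count b \<le> c" "x \<le> b" "4 * c \<le> x" for b c
      using prime_count_mono[OF that(2)] that by linarith
    consider "x \<le> 232" | "233 \<le> x" "x \<le> 276" | "277 \<le> x" "x \<le> 348" | "349 \<le> x"
      by linarith
    thus ?thesis
    proof cases
      case 1 thus ?thesis using less.prems by (intro *[of 232 50]) (simp_all add: prime_count_table)
    next
      case 2 thus ?thesis by (intro *[of 276 58]) (simp_all add: prime_count_table)
    next
      case 3 thus ?thesis by (intro *[of 348 69]) (simp_all add: prime_count_table)
    next
      case 4 thus ?thesis using True by (intro *[of 456 87]) (simp_all add: prime_count_table)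
    qed
  next
    case False
    hence "4 * prime_count (x - 210) \<le> x - 210" by (intro less.IH) auto
    moreover have "prime_count (x - 210 + 210) \<le> prime_count (x - 210) + 48"
      using False by (intro prime_count_add_210_le) simp
    moreover have "x - 210 + 210 = x" using False by simp
    ultimately show ?thesis by simp
  qed
qed

text \<open>The entry \<open>a\<close> last passed by \<open>m + k\<close> lies in the window, as
  \<open>g \<le> k\<close>. It is a prime or a multiple of a prime above \<open>2 * k\<close>, and
  both are excluded.\<close>

lemma smooth_cover_contradiction:
  fixes m k :: nat
  assumes "smooth_window m k" and no_prime: "\<And>p. prime p \<Longrightarrow> m < p \<Longrightarrow> \<not> p \<le> m + k"
    and "smooth_cover g l xs" "g \<le> k" "2 * k \<le> l" "11 \<le> m + k"
    and "m + k < last (11 # map (\<lambda>(c, p). c * p) xs)"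
  shows False
proof -
  obtain a b where ab: "a \<in> set (11 # map (\<lambda>(c, p). c * p) xs)" "b \<le> a + g" "a \<le> m + k" "m + k < b"
    using chain_bracket[of "\<lambda>a b. b \<le> a + g" 11 "map (\<lambda>(c, p). c * p) xs" "m + k"] assms
    unfolding smooth_cover_def by blast
  have "m < a" using ab assms(4) by linarith
  hence np: "\<not> prime a" using no_prime ab(3) by blast
  have "prime (11::nat)" by simp
  hence "a \<noteq> 11" using np by blast
  then obtain c p where cp: "(c, p) \<in> set xs" "a = c * p" using ab(1) by auto
  hence p: "prime p" "c = 1 \<or> l < p" using assms(3) by (auto simp: smooth_cover_def list_all_iff)
  hence "l < p" using np cp by auto
  moreover have "p \<le> 2 * k"
    using assms(1) p(1) cp(2) ab(3) \<open>m < a\<close> by (auto simp: smooth_window_def)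
  ultimately show False using assms(5) by simp
qed

text \<open>The relation \<open>R\<close> is kept abstract because admissible gaps may be absolute
  or relative to \<open>a\<close>.\<close>

lemma prime_chain_contradiction:
  fixes m k :: nat
  assumes no_prime: "\<And>p. prime p \<Longrightarrow> m < p \<Longrightarrow> \<not> p \<le> m + k"
    and "list_all prime xs" "chain R 11 xs" "11 \<le> m + k" "m + k < last (11 # xs)"
    and step: "\<And>a b. R a b \<Longrightarrow> a \<le> m + k \<Longrightarrow> m + k < b \<Longrightarrow> m < a"
  shows False
proof -
  obtain a b where ab: "a \<in> set (11 # xs)" "R a b" "a \<le> m + k" "m + k < b"
    using chain_bracket[OF assms(3-5)] by blast
  have "prime (11::nat)" by simp
  hence "prime a" using ab(1) assms(2) by (auto simp: list_all_iff)
  thus False using no_prime[of a] step[OF ab(2-4)] ab(3) by blast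
qed

text \<open>Bootstrapping: a bound \<open>m + k < c * k\<close> turns a lower bound on
  \<open>m + k\<close> into one on \<open>k\<close>, which admits a smaller \<open>c\<close>. It
  ends with \<open>m < 4 * k\<close>, since \<open>ln 4 > 1.212 > ln 3\<close>.\<close>

lemma smooth_window_less_multiples:
  assumes smooth: "smooth_window m k" and k: "100 \<le> k"
  shows "m + k < 30 * k"
    and "6000 \<le> m + k \<Longrightarrow> m + k < 11 * k"
    and "14000 \<le> m + k \<Longrightarrow> m + k < 7 * k"
    and "96000 \<le> m + k \<Longrightarrow> m + k < 5 * k"
proof -
  have "2 * prime_count (2 * k) \<le> k" using four_prime_count_le[of "2 * k"] k by simp
  with smooth have "4 * (m + 1) < k\<^sup>2" using k by (intro smooth_window_less_square) auto
  with smooth k show 30: "m + k < 30 * k" by (rule smooth_window_less_30)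
  have less: "m < c * k" if "200 \<le> k" "0 < c" "s\<^sup>2 \<le> k" "0 < s" "20.2 * s + 6.2 < (ln c - 1.212) * s\<^sup>2"
    for c :: nat and s :: real
    using smooth_window_contradiction[OF smooth that(1) _ _ that(2-5)] 30 by force
  have ln: "ln (15::real) = ln 3 + ln 5" "ln (10::real) = ln 2 + ln 5" "ln (6::real) = ln 2 + ln 3" "ln (4::real) = 2 * ln 2"
    using ln_mult[of 3 5] ln_mult[of 2 5] ln_mult[of 2 3] ln_mult[of 2 2] by simp_all
  note approx = ln_2_approx ln_3_approx ln_5_approx
  show 11: "m + k < 11 * k" if n: "6000 \<le> m + k"
  proof -
    \<comment> \<open>The values of \<open>s\<close> are lower bounds for \<open>sqrt k\<close>:
      \<open>14^2 < 6000 / 30\<close> and \<open>19^2 < 6000 / 16\<close>, later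
      \<open>35.5^2 < 14000 / 11\<close> and \<open>117^2 < 96000 / 7\<close>.\<close>
    have "m < 15 * k" using approx 30 n by (intro less[of 15 14]) (simp_all add: ln)
    hence "m < 10 * k" using approx n by (intro less[of 10 19]) (simp_all add: ln)
    thus ?thesis by simp
  qed
  show 7: "m + k < 7 * k" if n: "14000 \<le> m + k"
  proof -
    have "m < 6 * k" using approx 11 n by (intro less[of 6 "35.5"]) (simp_all add: ln power2_eq_square)
    thus ?thesis by simp
  qed
  show "m + k < 5 * k" if n: "96000 \<le> m + k"
  proof -
    have "m < 4 * k" using approx 7 n by (intro less[of 4 117]) (simp_all add: ln)
    thus ?thesis by simp
  qed
qed

lemma smooth_window_contains_prime:
  assumes smooth: "smooth_window m k" and "2 \<le> k" "11 \<le> m + k"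
  shows "\<exists>p. prime p \<and> m < p \<and> p \<le> m + k"
proof (rule ccontr)
  assume none: "\<not> ?thesis"
  hence no_prime: "\<not> p \<le> m + k" if "prime p" "m < p" for p using that by blast
  note cover = smooth_cover_contradiction[OF smooth no_prime _ _ _ \<open>11 \<le> m + k\<close>]
  consider "k = 2" | "k = 3" | "k = 4" | "5 \<le> k" "k \<le> 6" | "7 \<le> k" "k \<le> 13" | "14 \<le> k" "k \<le> 34"
    | "35 \<le> k" "k \<le> 99" | "100 \<le> k"
    using assms(2) by linarith
  thus False
  proof cases
    case 1
    hence "m + k \<le> 27" using smooth by (intro smooth_window_small) (simp_all add: prime_count_table)
    thus False using 1 by (intro cover[OF _ _ smooth_cover_2]) (simp_all add: smooth_cover_2_def)
  next
    case 2
    hence "m + k \<le> 27" using smooth by (intro smooth_window_small) (simp_all add: prime_count_table)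
    thus False using 2 by (intro cover[OF _ _ smooth_cover_3]) (simp_all add: smooth_cover_3_def)
  next
    case 3
    hence "m + k \<le> 27" using smooth by (intro smooth_window_small) (simp_all add: prime_count_table)
    thus False using 3 by (intro cover[OF _ _ smooth_cover_4]) (simp_all add: smooth_cover_4_def)
  next
    case 4
    hence "m + 1 < 121" using smooth by (intro smooth_window_less_121)
    thus False using 4 by (intro cover[OF _ _ smooth_cover_5_6]) (simp_all add: smooth_cover_5_6_def)
  next
    case 5
    hence "m + 1 < 721" using smooth by (intro smooth_window_less_721)
    thus False using 5 by (intro cover[OF _ _ smooth_cover_7_13]) (simp_all add: smooth_cover_7_13_def)
  next
    case 6
    hence "m + 1 < 480" using smooth by (intro smooth_window_less_480)
    thus False using 6 assms(3)
      by (intro prime_chain_contradiction[OF no_prime prime_chain_14_34]) (simp_all add: prime_chain_14_34_def)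
  next
    case 7
    hence "m + 1 < 1250" using smooth by (intro smooth_window_less_1250)
    thus False using 7 assms(3)
      by (intro prime_chain_contradiction[OF no_prime prime_chain_35_99]) (simp_all add: prime_chain_35_99_def)
  next
    case 8
    note less = smooth_window_less_multiples[OF smooth 8]
    show False
    proof (cases "m + k < 96000")
      case True
      \<comment> \<open>In the relative cases, for instance \<open>29 * b \<le> 30 * a\<close>, one
        gets \<open>a > (m + k) - (m + k) / 30\<close>, and \<open>(m + k) / 30 < k\<close>.\<close>
      have step: "m < a" if "chain_step a b" "a \<le> m + k" "m + k < b" for a b
        using that less 8 unfolding chain_step_def by linarith
      have primes: "list_all prime (prime_chain_100a @ prime_chain_100b @ prime_chain_100c)"
        using prime_chain_100a prime_chain_100b prime_chain_100c by simp
      have last: "m + k < last (11 # prime_chain_100a @ prime_chain_100b @ prime_chain_100c)"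
        using True by (simp add: prime_chain_100c_def)
      show False
        by (rule prime_chain_contradiction[OF _ primes chain_100 assms(3) last])
          (fact no_prime, fact step)
    next
      case False
      hence "\<exists>p. prime p \<and> m + k - k < p \<and> p \<le> m + k"
        using less(4) by (intro ex_prime_in_fifth) simp_all
      thus False using none by simp
    qed
  qed
qed

theorem theorem2:
  fixes n P k :: nat
  assumes "n > 10"
    and "P = Max {q. prime q \<and> q \<le> n}"
    and "2 \<le> k" and "k \<le> n - P"
  shows "\<exists>p::nat. prime p \<and> p > 2 * k \<and> (\<exists>i\<in>{0..k - 1}. p dvd n - i)"
proof (rule ccontr)
  assume none: "\<not> ?thesis"
  define m where "m = n - k"
  have n: "n = m + k" using assms(3,4) by (simp add: m_def)
  have "smooth_window m k"
    unfolding smooth_window_def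
  proof (intro allI impI)
    fix p x assume p: "prime p" and x: "x \<in> {m<..m+k}" and dvd: "p dvd x"
    have "n - x \<in> {0..k - 1}" "p dvd n - (n - x)" using x dvd by (auto simp: n)
    thus "p \<le> 2 * k" using none p by (meson not_le)
  qed
  then obtain q where q: "prime q" "m < q" "q \<le> n"
    using smooth_window_contains_prime[of m k] assms(1,3) n by auto
  \<comment> \<open>The hypothesis \<open>k \<le> n - P\<close> puts \<open>P\<close> at or below
    \<open>m\<close>, so a prime \<open>q > m\<close> contradicts maximality.\<close>
  hence "q \<le> P" unfolding assms(2) by (intro Max_ge) auto
  thus False using q assms(3,4) by (simp add: m_def)
qed

end
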